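(* Let $m,r,n,N$ be positive integers and let $M\in\mathbb{R}^{m\times n}$ with $\operatorname{rk}(M)=s\le r$. Let $f_1:\mathbb{R}^{m\times r}\times\mathbb{R}^{r\times n}\to\mathbb{R}$ be defined by $f_1(X,Y):=\|XY-M\|_1$. Let $\mathcal{A}:\mathbb{R}^{m\times n}\to\mathbb{R}^N$ be linear, $b\in\mathbb{R}^N$, $g_{\mathrm{ms}}(A):=|\mathcal{A}(A)-b|^2$ for $A\in\mathbb{R}^{m\times n}$, and $f_{\mathrm{ms}}:\mathbb{R}^{m\times r}\times\mathbb{R}^{r\times n}\to\mathbb{R}$, $f_{\mathrm{ms}}(X,Y):=g_{\mathrm{ms}}(XY)$. Assume that $g_{\mathrm{ms}}$ satisfies the $\delta$-$\mathrm{RIP}_{s+r,s+r}$ condition for some $\delta>0$. Moreover, assume that $M$ is a global minimum of $g_{\mathrm{ms}}$. Let $(\overline{X},\overline{Y})\in\mathbb{R}^{m\times r}\times\mathbb{R}^{r\times n}$ satisfy $\overline{X}\,\overline{Y}=M$. Then: (i) If $(\overline{X},\overline{Y})\in\mathcal{O}(p,q)$ with $\min\{m-s-p,\,n-s-q,\,r-s-p-q\}=0$, then $f_1$ has Kurdyka-Łojasiewicz exponent $0$, and $f_{\mathrm{ms}}$ has Kurdyka-Łojasiewicz exponent $1/2$, at $(\overline{X},\overline{Y})$. (ii) If $(\overline{X},\overline{Y})\in\mathcal{O}(p,q)$ with $\min\{m-s-p,\,n-s-q,\,r-s-p-q\}>0$, then $f_1$ has Kurdyka-Łojasiewicz exponent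 $1/2$, and $f_{\mathrm{ms}}$ has Kurdyka-Łojasiewicz exponent $3/4$, at $(\overline{X},\overline{Y})$.
   Context: $\|A\|_1$ is the entrywise $\ell_1$ norm (sum of absolute values of entries); $\|\cdot\|_F$ is the Frobenius norm; $|\cdot|$ is the Euclidean norm. $\mathrm{O}(k)$ is the group of orthogonal $k\times k$ matrices and $\mathrm{GL}(r)$ the group of invertible real $r\times r$ matrices. For $\delta>0$ and integers $w,t\ge 0$, a twice continuously differentiable $g:\mathbb{R}^{m\times n}\to\mathbb{R}$ satisfies the $\delta$-$\mathrm{RIP}_{w,t}$ condition if $(1-\delta)\|H\|_F^2\le\nabla^2g(A)[H,H]\le(1+\delta)\|H\|_F^2$ for all $A,H\in\mathbb{R}^{m\times n}$ with $\operatorname{rk}(A)\le w$ and $\operatorname{rk}(H)\le t$. The sets $\mathcal{O}(p,q)$: fix a singular value decomposition $M=U\begin{bmatrix}D&0\\0&0\end{bmatrix}V^\top$ with $U\in\mathrm{O}(m)$, $V\in\mathrm{O}(n)$ and $D\in\mathbb{R}^{s\times s}$ a positive diagonal matrix. The group $G:=\mathrm{O}(m-s)\times\mathrm{GL}(r)\times\mathrm{O}(n-s)$ acts on $\mathbb{R}^{m\times r}\times\mathbb{R}^{r\times n}$ by $$(Q_1,A,Q_2)\cdot(X,Y):=\left(\operatorname{diag}(I_s,Q_1)^\top XA,\;A^{-1}Y\operatorname{diag}(I_s,Q_2)\right).$$ For nonnegative integers $p,q$ with $\min\{m-s-p,\,n-s-q,\,r-s-p-q\}\ge 0$, $\mathcal{O}(p,q)$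 is the orbit $$\mathcal{O}(p,q):=G\cdot\left(U\begin{bmatrix}I_s&0&0&0\\0&I_p&0&0\\0&0&0&0\end{bmatrix},\;\begin{bmatrix}D&0&0\\0&0&0\\0&I_q&0\\0&0&0\end{bmatrix}V^\top\right),$$ where the columns of the first block matrix (of size $m\times r$) and the rows of the second (of size $r\times n$) are split into blocks of sizes $s,p,q,r-s-p-q$, the rows of the first into $s,p,m-s-p$, and the columns of the second into $s,q,n-s-q$. Kurdyka-Łojasiewicz exponent: a locally Lipschitz function $f$ on a Euclidean space has Kurdyka-Łojasiewicz exponent $\alpha\in[0,1)$ at $\overline{x}$ if there exist $\rho,\ell,c>0$ such that $d(0,\overline\partial f(x))\ge c(f(x)-f(\overline{x}))^\alpha$ for all $x\in B_\rho(\overline{x})$ with $0<f(x)-f(\overline{x})<\ell$, where $\overline\partial f$ is the Clarke subdifferential (the convex hull of limits of gradients of $f$ at nearby points of differentiability) and $d(0,S)=\inf_{v\in S}|v|$.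
   Formalization: The RIP constant is assumed to satisfy 0 < δ < 1, not only δ > 0: for δ ≥ 1 the lower bound is vacuous and the f_ms claim in (i) can fail, e.g. m=n=2, r=N=1, M=0, b=0, A(Z)=Z_11, δ=1, at X=(0,1)^T, Y=0. *)

theory Defs
  imports "HOL-Analysis.Analysis" "HOL-Library.Countable_Set"
begin

section \<open>Norms, the restricted isometry condition, matrix sensing\<close>

text \<open>
  An $m \times n$ matrix has type \<^typ>\<open>real ^ 'n ^ 'm\<close>, with $m$ = \<open>CARD('m)\<close> and
  $n$ = \<open>CARD('n)\<close>. The library norm of this type is the Frobenius norm, and on the
  product \<open>(real ^ 'r ^ 'm) \<times> (real ^ 'n ^ 'r)\<close> it is the Euclidean norm of the pair.
\<close>

definition norm_l1 :: "real ^ 'n ^ 'm \<Rightarrow> real" where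
  "norm_l1 A = (\<Sum>i\<in>UNIV. \<Sum>j\<in>UNIV. \<bar>A $ i $ j\<bar>)"

text \<open>\<open>g'' A H K\<close> is the second derivative of \<open>g\<close> at \<open>A\<close> in directions \<open>H\<close> and \<open>K\<close>;
  \<open>g'\<close> and \<open>g''\<close> are uniquely determined by \<open>g\<close>.\<close>

definition C2_with_derivatives ::
  "('a::euclidean_space \<Rightarrow> real) \<Rightarrow> ('a \<Rightarrow> 'a \<Rightarrow>\<^sub>L real) \<Rightarrow> ('a \<Rightarrow> 'a \<Rightarrow>\<^sub>L 'a \<Rightarrow>\<^sub>L real) \<Rightarrow> bool" where
  "C2_with_derivatives g g' g'' \<longleftrightarrow>
     (\<forall>A. (g has_derivative blinfun_apply (g' A)) (at A)) \<and>
     (\<forall>A. (g' has_derivative blinfun_apply (g'' A)) (at A)) \<and>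
     continuous_on UNIV g''"

text \<open>For \<open>\<delta> \<ge> 1\<close> the lower bound below carries no information, and the claims about \<open>f_ms\<close> can
  fail: take $m = n = 2$, $r = 1$, $M = 0$, $b = 0$ and $\mathcal{A}(Z) = Z_{11}$, for which
  $\delta = 1$ is admissible and $f_{\mathrm{ms}}(X,Y) = (x_1 y_1)^2$ does not have exponent $1/2$
  at $x = (0,1)$, $y = 0$. The theorem therefore assumes \<open>0 < \<delta> < 1\<close>.\<close>

definition RIP :: "real \<Rightarrow> nat \<Rightarrow> nat \<Rightarrow> (real ^ 'n ^ 'm \<Rightarrow> real) \<Rightarrow> bool" where
  "RIP \<delta> w t g \<longleftrightarrow>
     (\<exists>g' g''. C2_with_derivatives g g' g'' \<and>
        (\<forall>A H. rank A \<le> w \<and> rank H \<le> t \<longrightarrow>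
           (1 - \<delta>) * (norm H)\<^sup>2 \<le> blinfun_apply (blinfun_apply (g'' A) H) H \<and>
           blinfun_apply (blinfun_apply (g'' A) H) H \<le> (1 + \<delta>) * (norm H)\<^sup>2))"

definition g_ms :: "(real ^ 'n ^ 'm \<Rightarrow> real ^ 'N) \<Rightarrow> real ^ 'N \<Rightarrow> real ^ 'n ^ 'm \<Rightarrow> real" where
  "g_ms \<A> b A = (norm (\<A> A - b))\<^sup>2"

definition f_ms ::
  "(real ^ 'n ^ 'm \<Rightarrow> real ^ 'N) \<Rightarrow> real ^ 'N \<Rightarrow> (real ^ 'r ^ 'm) \<times> (real ^ 'n ^ 'r) \<Rightarrow> real" where
  "f_ms \<A> b = (\<lambda>(X, Y). g_ms \<A> b (X ** Y))"

definition f_1 :: "real ^ 'n ^ 'm \<Rightarrow> (real ^ 'r ^ 'm) \<times> (real ^ 'n ^ 'r) \<Rightarrow> real" where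
  "f_1 M = (\<lambda>(X, Y). norm_l1 (X ** Y - M))"


section \<open>The Clarke subdifferential and Kurdyka-Lojasiewicz exponents\<close>

definition locally_lipschitz :: "('a::euclidean_space \<Rightarrow> real) \<Rightarrow> bool" where
  "locally_lipschitz f \<longleftrightarrow> (\<forall>x. \<exists>\<epsilon>>0. \<exists>L. L-lipschitz_on (ball x \<epsilon>) f)"

definition clarke_subdifferential :: "('a::euclidean_space \<Rightarrow> real) \<Rightarrow> 'a \<Rightarrow> 'a set" where
  "clarke_subdifferential f x =
     convex hull {v. \<exists>y d. y \<longlonglongrightarrow> x \<and> (\<forall>k::nat. GDERIV f (y k) :> d k) \<and> d \<longlonglongrightarrow> v}"

text \<open>For a locally Lipschitz function the Clarke subdifferential is nonempty, so that
  \<^term>\<open>infdist 0 (clarke_subdifferential f x)\<close> is the genuine infimum of norms.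
  Under the guard \<open>0 < f x - f x0\<close>, \<open>powr\<close> with exponent \<open>0\<close> gives \<open>1\<close>.\<close>

definition has_KL_exponent :: "('a::euclidean_space \<Rightarrow> real) \<Rightarrow> real \<Rightarrow> 'a \<Rightarrow> bool" where
  "has_KL_exponent f \<alpha> x0 \<longleftrightarrow>
     locally_lipschitz f \<and> 0 \<le> \<alpha> \<and> \<alpha> < 1 \<and>
     (\<exists>\<rho> l c. 0 < \<rho> \<and> 0 < l \<and> 0 < c \<and>
        (\<forall>x\<in>ball x0 \<rho>. 0 < f x - f x0 \<and> f x - f x0 < l \<longrightarrow>
           c * (f x - f x0) powr \<alpha> \<le> infdist 0 (clarke_subdifferential f x)))"


section \<open>Singular value decompositions and the sets O(p,q)\<close>

text \<open>
  Block decompositions need an ordering of the rows and columns. We number the elements of a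
  finite index type by $0, \dots, k-1$, where $k$ is its cardinality (a bijection by
  \<open>to_nat_on_finite\<close>).
\<close>

definition pos :: "'k::finite \<Rightarrow> nat" where
  "pos = to_nat_on UNIV"

text \<open>Matrices whose size is a number such as $m - s$, rather than the cardinality of a type,
  are functions \<open>nat \<Rightarrow> nat \<Rightarrow> real\<close>, of which only the entries with indices below the size
  are used. Accordingly this is the orthogonal group of size \<open>k\<close>.\<close>

definition orthogonal_grp :: "nat \<Rightarrow> (nat \<Rightarrow> nat \<Rightarrow> real) set" where
  "orthogonal_grp k =
     {Q. \<forall>i<k. \<forall>j<k. (\<Sum>l<k. Q l i * Q l j) = (if i = j then 1 else 0) \<and>
                       (\<Sum>l<k. Q i l * Q j l) = (if i = j then 1 else 0)}"

text \<open>$\mathrm{diag}(I_s, Q)$\<close>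

definition diag_I :: "nat \<Rightarrow> (nat \<Rightarrow> nat \<Rightarrow> real) \<Rightarrow> real ^ 'k ^ 'k" where
  "diag_I s Q = (\<chi> i j.
     if pos i < s \<and> pos j < s then (if pos i = pos j then 1 else 0)
     else if s \<le> pos i \<and> s \<le> pos j then Q (pos i - s) (pos j - s)
     else 0)"

text \<open>The $m \times n$ matrix with upper left block $D = \mathrm{diag}(d_0, \dots, d_{s-1})$
  and zeros elsewhere.\<close>

definition diag_block :: "nat \<Rightarrow> (nat \<Rightarrow> real) \<Rightarrow> real ^ 'n ^ 'm" where
  "diag_block s d = (\<chi> i j. if pos i = pos j \<and> pos i < s then d (pos i) else 0)"

definition is_svd ::
  "nat \<Rightarrow> real ^ 'm ^ 'm \<Rightarrow> (nat \<Rightarrow> real) \<Rightarrow> real ^ 'n ^ 'n \<Rightarrow> real ^ 'n ^ 'm \<Rightarrow> bool" where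
  "is_svd s U d V M \<longleftrightarrow>
     s \<le> CARD('m) \<and> s \<le> CARD('n) \<and> orthogonal_matrix U \<and> orthogonal_matrix V \<and>
     (\<forall>k<s. 0 < d k) \<and> M = U ** diag_block s d ** transpose V"

text \<open>The block matrix with diagonal blocks $I_s$, $I_p$ (the columns are split into
  $s, p, q, r-s-p-q$ and the rows into $s, p, m-s-p$).\<close>

definition left_block :: "nat \<Rightarrow> nat \<Rightarrow> real ^ 'r ^ 'm" where
  "left_block s p = (\<chi> i j. if pos i = pos j \<and> pos i < s + p then 1 else 0)"

text \<open>The block matrix with blocks $D$ and $I_q$, where the rows are split into
  $s, p, q, r-s-p-q$ and the columns into $s, q, n-s-q$: the block $I_q$ starts in row
  $s + p$ and column $s$.\<close>

definition right_block :: "nat \<Rightarrow> (nat \<Rightarrow> real) \<Rightarrow> nat \<Rightarrow> nat \<Rightarrow> real ^ 'n ^ 'r" where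
  "right_block s d p q = (\<chi> i j.
     if pos i = pos j \<and> pos i < s then d (pos i)
     else if (\<exists>k<q. pos i = s + p + k \<and> pos j = s + k) then 1
     else 0)"

definition act ::
  "nat \<Rightarrow> (nat \<Rightarrow> nat \<Rightarrow> real) \<Rightarrow> real ^ 'r ^ 'r \<Rightarrow> (nat \<Rightarrow> nat \<Rightarrow> real) \<Rightarrow>
   (real ^ 'r ^ 'm) \<times> (real ^ 'n ^ 'r) \<Rightarrow> (real ^ 'r ^ 'm) \<times> (real ^ 'n ^ 'r)" where
  "act s Q1 A Q2 = (\<lambda>(X, Y).
     (transpose (diag_I s Q1) ** X ** A, matrix_inv A ** Y ** diag_I s Q2))"

definition orbit_O ::
  "nat \<Rightarrow> real ^ 'm ^ 'm \<Rightarrow> (nat \<Rightarrow> real) \<Rightarrow> real ^ 'n ^ 'n \<Rightarrow> nat \<Rightarrow> nat \<Rightarrow>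
   ((real ^ 'r ^ 'm) \<times> (real ^ 'n ^ 'r)) set" where
  "orbit_O s U d V p q =
     {act s Q1 A Q2 (U ** left_block s p, right_block s d p q ** transpose V) | Q1 A Q2.
        Q1 \<in> orthogonal_grp (CARD('m) - s) \<and> invertible A \<and>
        Q2 \<in> orthogonal_grp (CARD('n) - s)}"

text \<open>The slack $\min\{m-s-p,\ n-s-q,\ r-s-p-q\}$, an integer. The set $O(p,q)$ is only
  considered when it is nonnegative.\<close>

definition slack :: "nat \<Rightarrow> nat \<Rightarrow> nat \<Rightarrow> nat \<Rightarrow> nat \<Rightarrow> nat \<Rightarrow> int" where
  "slack m r n s p q =
     Min {int m - int s - int p, int n - int s - int q, int r - int s - int p - int q}"

end

theory Submission
  imports Defs
begin

text \<open>
  Write \<open>M = X0 ** Y0\<close> for the point \<open>(X0, Y0)\<close> under study and \<open>E = X ** Y - M\<close> for the error of a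
  nearby point. Both objectives have the form \<open>h (X ** Y)\<close> with \<open>h\<close> convex, and \<open>h (M + E) - h M\<close> is
  comparable to \<open>norm E\<close> to the power \<open>\<kappa>\<close>, with \<open>\<kappa> = 1\<close> for \<open>f_1\<close> and \<open>\<kappa> = 2\<close> for \<open>f_ms\<close>; in the
  second case the lower bound is the restricted isometry condition, applied to the matrix \<open>E\<close>, whose
  rank is at most \<open>s + r\<close>.

  Convexity turns any direction \<open>(H, K)\<close> into a lower bound for Clarke subgradients \<open>v\<close>: the derivative
  of the product is \<open>X ** K + H ** Y\<close>, and
  \<open>(H, K) \<bullet> v \<ge> h (X ** Y) - h (X ** Y - (X ** K + H ** Y))\<close> (\<open>clarke_product_ge_decrease\<close>).
  If \<open>X ** K + H ** Y\<close> equals \<open>E\<close> up to a small relative error, then the right-hand side is at least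
  half of the gap \<open>h (X ** Y) - h M\<close>, so \<open>norm v\<close> is at least this half divided by \<open>norm (H, K)\<close>.
  Everything hence depends on how small \<open>(H, K)\<close> can be chosen: if its norm is at most a multiple of
  \<open>norm E powr \<theta>\<close>, the exponent is \<open>1 - \<theta> / \<kappa>\<close> (\<open>has_KL_exponent_product\<close>).

  With \<open>\<theta> = 1 / 2\<close> this is always possible (\<open>product_error_linearizable_half\<close>), by a Tikhonov-regularized
  solution with parameter \<open>\<tau>\<^sup>2 = norm E\<close>. With \<open>\<theta> = 1\<close> it is possible if one of the three numbers in
  the slack vanishes: if \<open>X0\<close> has a right inverse, if \<open>Y0\<close> has a left inverse, or if the kernel of \<open>X0\<close>
  lies in the range of \<open>Y0\<close> (\<open>product_error_linearizable_one_if_right_inverse\<close>,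
  \<open>product_error_linearizable_one_if_left_inverse\<close>,
  \<open>product_error_linearizable_one_if_kernel_in_range\<close>). Combining the two values of \<open>\<theta>\<close> with the two
  values of \<open>\<kappa>\<close> gives the exponents $0$, $1/2$, $1/2$, $3/4$.
\<close>

section \<open>Multiplication of matrices\<close>

lemma norm_matrix_squared:
  fixes A :: "real ^ 'n ^ 'm"
  shows "(norm A)\<^sup>2 = (\<Sum>i\<in>UNIV. \<Sum>j\<in>UNIV. (A $ i $ j)\<^sup>2)"
  unfolding power2_norm_eq_inner by (simp add: inner_vec_def power2_eq_square)

text \<open>The Frobenius norm is submultiplicative: each entry of the product is bounded by the
  Cauchy-Schwarz inequality for a row of \<open>A\<close> and a column of \<open>B\<close>.\<close>

lemma norm_matrix_mult_le:
  fixes A :: "real ^ 'k ^ 'm" and B :: "real ^ 'n ^ 'k"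
  shows "norm (A ** B) \<le> norm A * norm B"
proof -
  have entry: "((A ** B) $ i $ j)\<^sup>2 \<le> (\<Sum>k\<in>UNIV. (A $ i $ k)\<^sup>2) * (\<Sum>k\<in>UNIV. (B $ k $ j)\<^sup>2)" for i j
    unfolding matrix_matrix_mult_def by (simp add: Cauchy_Schwarz_ineq_sum)
  have "(norm (A ** B))\<^sup>2
      \<le> (\<Sum>i\<in>UNIV. \<Sum>j\<in>UNIV. (\<Sum>k\<in>UNIV. (A $ i $ k)\<^sup>2) * (\<Sum>k\<in>UNIV. (B $ k $ j)\<^sup>2))"
    unfolding norm_matrix_squared by (intro sum_mono entry)
  also have "\<dots> = (\<Sum>i\<in>UNIV. \<Sum>k\<in>UNIV. (A $ i $ k)\<^sup>2) * (\<Sum>j\<in>UNIV. \<Sum>k\<in>UNIV. (B $ k $ j)\<^sup>2)"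
    by (simp add: sum_product)
  also have "(\<Sum>j\<in>UNIV. \<Sum>k\<in>UNIV. (B $ k $ j)\<^sup>2) = (norm B)\<^sup>2"
    unfolding norm_matrix_squared by (rule sum.swap)
  also have "(\<Sum>i\<in>UNIV. \<Sum>k\<in>UNIV. (A $ i $ k)\<^sup>2) = (norm A)\<^sup>2"
    unfolding norm_matrix_squared ..
  finally have "(norm (A ** B))\<^sup>2 \<le> (norm A * norm B)\<^sup>2"
    by (simp add: power_mult_distrib)
  then show ?thesis
    by (rule power2_le_imp_le) simp
qed

lemma bounded_bilinear_matrix_mult:
  "bounded_bilinear ((**) :: real ^ 'k ^ 'm \<Rightarrow> real ^ 'n ^ 'k \<Rightarrow> real ^ 'n ^ 'm)"
proof
  show "\<exists>K. \<forall>A B. norm ((A :: real ^ 'k ^ 'm) ** (B :: real ^ 'n ^ 'k)) \<le> norm A * norm B * K"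
    by (rule exI[of _ 1]) (simp add: norm_matrix_mult_le)
qed (simp_all add: matrix_matrix_mult_def vec_eq_iff distrib_left distrib_right sum.distrib
  sum_distrib_left mult_ac)

lemmas matrix_mult_ring_simps =
  bounded_bilinear.add_left[OF bounded_bilinear_matrix_mult]
  bounded_bilinear.add_right[OF bounded_bilinear_matrix_mult]
  bounded_bilinear.diff_left[OF bounded_bilinear_matrix_mult]
  bounded_bilinear.diff_right[OF bounded_bilinear_matrix_mult]

lemmas matrix_mult_scaleR =
  bounded_bilinear.scaleR_left[OF bounded_bilinear_matrix_mult]
  bounded_bilinear.scaleR_right[OF bounded_bilinear_matrix_mult]

lemmas matrix_mult_zero =
  bounded_bilinear.zero_left[OF bounded_bilinear_matrix_mult]
  bounded_bilinear.zero_right[OF bounded_bilinear_matrix_mult]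

lemmas tendsto_matrix_mult = bounded_bilinear.tendsto[OF bounded_bilinear_matrix_mult]

lemma inner_matrix_mult_left:
  fixes A :: "real ^ 'n ^ 'm" and B :: "real ^ 'k ^ 'm" and C :: "real ^ 'n ^ 'k"
  shows "A \<bullet> (B ** C) = (transpose B ** A) \<bullet> C"
proof -
  have "A \<bullet> (B ** C) = (\<Sum>i\<in>UNIV. \<Sum>j\<in>UNIV. \<Sum>k\<in>UNIV. A $ i $ j * (B $ i $ k * C $ k $ j))"
    by (simp add: inner_vec_def matrix_matrix_mult_def sum_distrib_left)
  also have "\<dots> = (\<Sum>i\<in>UNIV. \<Sum>k\<in>UNIV. \<Sum>j\<in>UNIV. A $ i $ j * (B $ i $ k * C $ k $ j))"
    by (intro sum.cong refl sum.swap)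
  also have "\<dots> = (\<Sum>k\<in>UNIV. \<Sum>i\<in>UNIV. \<Sum>j\<in>UNIV. A $ i $ j * (B $ i $ k * C $ k $ j))"
    by (rule sum.swap)
  also have "\<dots> = (\<Sum>k\<in>UNIV. \<Sum>j\<in>UNIV. \<Sum>i\<in>UNIV. A $ i $ j * (B $ i $ k * C $ k $ j))"
    by (intro sum.cong refl sum.swap)
  also have "\<dots> = (transpose B ** A) \<bullet> C"
    by (simp add: inner_vec_def matrix_matrix_mult_def transpose_def sum_distrib_left mult_ac)
  finally show ?thesis .
qed

text \<open>The hypothesis is stated for matrices because norm estimates below are all in the Frobenius norm; on
  a matrix whose columns all equal a vector of the kernel, it shows that this vector is zero.\<close>

lemma right_inverse_exists_of_lower_bound:
  fixes J :: "real ^ 'm ^ 'm"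
  assumes "0 < c" and "\<And>Z :: real ^ 'm ^ 'm. c * norm Z \<le> norm (J ** Z)"
  obtains S where "J ** S = mat 1"
proof -
  have "v = 0" if "J *v v = 0" for v
  proof -
    let ?Z = "(\<chi> i j. v $ i) :: real ^ 'm ^ 'm"
    have "J ** ?Z = 0"
      using that by (simp add: vec_eq_iff matrix_matrix_mult_def matrix_vector_mult_def)
    then have "c * norm ?Z \<le> 0"
      using assms(2)[of ?Z] by simp
    then have "norm ?Z \<le> 0"
      using \<open>0 < c\<close> by (simp add: mult_le_0_iff)
    then show ?thesis
      by (simp add: vec_eq_iff)
  qed
  then have "inj ((*v) J)"
    by (simp add: linear_injective_0)
  then obtain S where "S ** J = mat 1"
    using matrix_left_invertible_injective by blast
  then show thesis
    using that matrix_left_right_inverse by blast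
qed

lemma norm_le_of_mult:
  fixes A :: "real ^ 'k ^ 'm" and B :: "real ^ 'n ^ 'k"
  assumes "norm A \<le> a" "norm B \<le> b"
  shows "norm (A ** B) \<le> a * b"
  using norm_matrix_mult_le[of A B] mult_mono[OF assms order_trans[OF norm_ge_zero assms(1)] norm_ge_zero]
  by (rule order_trans)


section \<open>The linearized equation for the product error\<close>

text \<open>The next lemmas concern the Tikhonov regularization of the equation \<open>X ** K = A\<close>. Its solution is
  \<open>K = transpose X ** (S ** A)\<close>, where \<open>S\<close> is the inverse of \<open>X ** transpose X + \<tau>\<^sup>2\<close>, and
  \<open>\<tau>\<^sup>2 *\<^sub>R (S ** A)\<close> is the residual. All bounds come from one energy identity, which is the
  equation tested with \<open>S ** A\<close>. They are uniform in \<open>X\<close>, even if \<open>X\<close> has arbitrarily small singular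
  values.\<close>

context
  fixes X :: "real ^ 'r ^ 'm" and S :: "real ^ 'm ^ 'm" and \<tau> :: real
  assumes \<tau>: "0 < \<tau>"
    and S: "(X ** transpose X + \<tau>\<^sup>2 *\<^sub>R mat 1) ** S = mat 1"
begin

lemma regularized_decomposition:
  "X ** (transpose X ** (S ** A)) + \<tau>\<^sup>2 *\<^sub>R (S ** A) = A"
  for A :: "real ^ 'n ^ 'm"
proof -
  have "((X ** transpose X + \<tau>\<^sup>2 *\<^sub>R mat 1) ** S) ** A = A"
    by (simp add: S)
  then show ?thesis
    by (simp add: matrix_mult_ring_simps matrix_mult_scaleR matrix_mul_assoc)
qed

lemma regularized_energy:
  "(norm (transpose X ** (S ** A)))\<^sup>2 + \<tau>\<^sup>2 * (norm (S ** A))\<^sup>2 = (S ** A) \<bullet> A"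
  for A :: "real ^ 'n ^ 'm"
proof -
  have "(S ** A) \<bullet> A = (S ** A) \<bullet> (X ** (transpose X ** (S ** A)) + \<tau>\<^sup>2 *\<^sub>R (S ** A))"
    by (simp only: regularized_decomposition)
  then show ?thesis
    by (simp add: inner_add_right inner_matrix_mult_left power2_norm_eq_inner)
qed

lemma regularized_residual_le: "\<tau>\<^sup>2 * norm (S ** A) \<le> norm A"
  for A :: "real ^ 'n ^ 'm"
proof (cases "S ** A = 0")
  case False
  have "\<tau>\<^sup>2 * (norm (S ** A))\<^sup>2 \<le> (S ** A) \<bullet> A"
    using regularized_energy[of A] zero_le_power2[of "norm (transpose X ** (S ** A))"] by linarith
  also have "\<dots> \<le> norm (S ** A) * norm A"
    by (rule norm_cauchy_schwarz)
  finally have "norm (S ** A) * (\<tau>\<^sup>2 * norm (S ** A)) \<le> norm (S ** A) * norm A"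
    by (simp add: power2_eq_square mult_ac)
  then show ?thesis
    using False by simp
qed simp

lemma regularized_solution_le: "\<tau> * norm (transpose X ** (S ** A)) \<le> norm A"
  for A :: "real ^ 'n ^ 'm"
proof -
  have "(norm (transpose X ** (S ** A)))\<^sup>2 \<le> (S ** A) \<bullet> A"
    using regularized_energy[of A] mult_nonneg_nonneg[OF zero_le_power2 zero_le_power2, of \<tau> "norm (S ** A)"]
    by linarith
  also have "\<dots> \<le> norm (S ** A) * norm A"
    by (rule norm_cauchy_schwarz)
  finally have "\<tau>\<^sup>2 * (norm (transpose X ** (S ** A)))\<^sup>2 \<le> \<tau>\<^sup>2 * (norm (S ** A) * norm A)"
    using \<tau> by (simp add: mult_left_mono)
  also have "\<dots> \<le> norm A * norm A"
    using mult_right_mono[OF regularized_residual_le[of A], of "norm A"] by (simp add: mult_ac)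
  finally have "(\<tau> * norm (transpose X ** (S ** A)))\<^sup>2 \<le> (norm A)\<^sup>2"
    by (simp only: power_mult_distrib power2_eq_square[of "norm A"])
  then show ?thesis
    by (rule power2_le_imp_le) simp
qed

text \<open>For \<open>A = X\<close> the residual is of order \<open>\<tau>\<close>: writing \<open>X = X ** mat 1\<close>, the right-hand side of the
  energy identity becomes linear in \<open>transpose X ** (S ** X)\<close>, which the identity then bounds by a
  constant that does not depend on \<open>\<tau>\<close>.\<close>

lemma regularized_residual_self_le: "\<tau> * norm (S ** X) \<le> norm (mat 1 :: real ^ 'r ^ 'r)"
proof -
  let ?c = "norm (mat 1 :: real ^ 'r ^ 'r)" and ?t = "norm (transpose X ** (S ** X))"
  have "(S ** X) \<bullet> X = X \<bullet> (S ** X)"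
    by (rule inner_commute)
  also have "X \<bullet> (S ** X) = (S ** X) \<bullet> (X ** mat 1)"
    by (simp add: inner_commute)
  also have "\<dots> = (transpose X ** (S ** X)) \<bullet> mat 1"
    by (rule inner_matrix_mult_left)
  also have "\<dots> \<le> ?t * ?c"
    by (rule norm_cauchy_schwarz)
  finally have e: "?t\<^sup>2 + \<tau>\<^sup>2 * (norm (S ** X))\<^sup>2 \<le> ?t * ?c"
    using regularized_energy[of X] by simp
  have "?t * ?c \<le> ?t\<^sup>2 + ?c\<^sup>2"
    using sum_squares_bound[of ?t ?c] mult_nonneg_nonneg[OF norm_ge_zero norm_ge_zero, of "transpose X ** (S ** X)" "mat 1 :: real ^ 'r ^ 'r"]
    by linarith
  with e have "(\<tau> * norm (S ** X))\<^sup>2 \<le> ?c\<^sup>2"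
    by (simp add: power_mult_distrib)
  then show ?thesis
    by (rule power2_le_imp_le) simp
qed

end

lemma regularized_inverse_exists:
  fixes X :: "real ^ 'r ^ 'm"
  assumes "0 < \<tau>"
  obtains S :: "real ^ 'm ^ 'm" where "(X ** transpose X + \<tau>\<^sup>2 *\<^sub>R mat 1) ** S = mat 1"
proof (rule right_inverse_exists_of_lower_bound)
  show "0 < \<tau>\<^sup>2"
    using assms by simp
  fix Z :: "real ^ 'm ^ 'm"
  let ?J = "X ** transpose X + \<tau>\<^sup>2 *\<^sub>R mat 1"
  have "Z \<bullet> (?J ** Z) = (norm (transpose X ** Z))\<^sup>2 + \<tau>\<^sup>2 * (norm Z)\<^sup>2"
    by (simp add: matrix_mult_ring_simps matrix_mult_scaleR inner_add_right
      matrix_mul_assoc[symmetric] inner_matrix_mult_left power2_norm_eq_inner)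
  then have "\<tau>\<^sup>2 * (norm Z)\<^sup>2 \<le> norm Z * norm (?J ** Z)"
    using norm_cauchy_schwarz[of Z "?J ** Z"] zero_le_power2[of "norm (transpose X ** Z)"]
    by linarith
  then have "norm Z * (\<tau>\<^sup>2 * norm Z) \<le> norm Z * norm (?J ** Z)"
    by (simp add: power2_eq_square mult_ac)
  then show "\<tau>\<^sup>2 * norm Z \<le> norm (?J ** Z)"
    by (cases "Z = 0") simp_all
qed (rule that)

text \<open>The derivative of the matrix product at \<open>(X, Y)\<close> in direction \<open>(H, K)\<close> is \<open>X ** K + H ** Y\<close>. Thus
  \<open>\<theta>\<close> measures how small a direction can be that removes almost all of the error \<open>E\<close> of the product
  to first order; a larger \<open>\<theta>\<close> is a stronger property.\<close>

definition product_error_linearizable ::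
  "real \<Rightarrow> real ^ 'r ^ 'm \<Rightarrow> real ^ 'n ^ 'r \<Rightarrow> bool" where
  "product_error_linearizable \<theta> X0 Y0 \<longleftrightarrow>
     (\<forall>\<epsilon>>0. \<exists>C>0. \<forall>\<^sub>F (X, Y) in nhds (X0, Y0). \<exists>H K.
        norm ((X ** Y - X0 ** Y0) - (X ** K + H ** Y)) \<le> \<epsilon> * norm (X ** Y - X0 ** Y0) \<and>
        norm (H, K) \<le> C * norm (X ** Y - X0 ** Y0) powr \<theta>)"

lemma tendsto_pair_nhds:
  "(fst \<longlongrightarrow> X0) (nhds (X0, Y0))" "(snd \<longlongrightarrow> Y0) (nhds (X0, Y0))"
  using tendsto_fst[OF filterlim_ident, of "(X0, Y0)"] tendsto_snd[OF filterlim_ident, of "(X0, Y0)"]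
  by simp_all

lemma eventually_norm_less:
  assumes "(f \<longlongrightarrow> l) F" "norm l < a"
  shows "\<forall>\<^sub>F z in F. norm (f z) < a"
  using order_tendstoD(2)[OF tendsto_norm[OF assms(1)] assms(2)] .

lemma product_error_tendsto_0:
  fixes X0 :: "real ^ 'r ^ 'm" and Y0 :: "real ^ 'n ^ 'r"
  shows "((\<lambda>z. fst z ** snd z - X0 ** Y0) \<longlongrightarrow> 0) (nhds (X0, Y0))"
proof -
  have "((\<lambda>z. fst z ** snd z - X0 ** Y0) \<longlongrightarrow> X0 ** Y0 - X0 ** Y0) (nhds (X0, Y0))"
    by (intro tendsto_diff tendsto_matrix_mult tendsto_pair_nhds tendsto_const)
  then show ?thesis
    by simp
qed

text \<open>A solution without any condition on the ranks, where \<open>E = X ** Y - M\<close> and \<open>\<tau>\<^sup>2 = norm E\<close>. The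
  regularized solution \<open>K\<close> of \<open>X ** K = E\<close> is of order \<open>\<tau>\<close> and leaves the residual \<open>T ** E\<close> with
  \<open>T = \<tau>\<^sup>2 *\<^sub>R S\<close>. In \<open>T ** E = T ** (X ** Y) - T ** M\<close> the first term has the form \<open>H ** Y\<close>. The second
  has it too up to a small error, because the generalized inverse \<open>N\<close> gives
  \<open>M = M ** N ** M = M ** N ** (X ** Y - E)\<close>. This leaves the error \<open>T ** M ** N ** E\<close>, which is small
  relative to \<open>E\<close> since \<open>T ** M = (T ** X) ** Y - T ** E\<close> is of order \<open>\<tau>\<close>.\<close>

lemma product_error_linearizable_half:
  fixes X0 :: "real ^ 'r ^ 'm" and Y0 :: "real ^ 'n ^ 'r"
  assumes N: "(X0 ** Y0) ** N ** (X0 ** Y0) = X0 ** Y0"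
  shows "product_error_linearizable (1 / 2) X0 Y0"
  unfolding product_error_linearizable_def
proof (intro allI impI)
  fix \<epsilon> :: real assume "0 < \<epsilon>"
  define M where "M = X0 ** Y0"
  define a where "a = norm X0 + 1"
  define b where "b = norm Y0 + 1"
  define c where "c = norm (mat 1 :: real ^ 'r ^ 'r)"
  define n where "n = norm N"
  have nonneg: "0 \<le> a" "0 \<le> b" "0 \<le> c" "0 \<le> n"
    by (simp_all add: a_def b_def c_def n_def)
  define C where "C = 1 + c + (c * b + 1) * n * a"
  have "0 < C"
    unfolding C_def using nonneg by (intro add_pos_nonneg mult_nonneg_nonneg add_nonneg_nonneg) simp_all
  have "((\<lambda>z. sqrt (norm (fst z ** snd z - X0 ** Y0)) * ((c * b + 1) * n)) \<longlongrightarrow> 0) (nhds (X0, Y0))"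
  proof (rule tendsto_mult_left_zero)
    show "((\<lambda>z. sqrt (norm (fst z ** snd z - X0 ** Y0))) \<longlongrightarrow> 0) (nhds (X0, Y0))"
      using tendsto_real_sqrt[OF tendsto_norm[OF product_error_tendsto_0[of X0 Y0]]] by simp
  qed
  then have small: "\<forall>\<^sub>F z in nhds (X0, Y0). sqrt (norm (fst z ** snd z - X0 ** Y0)) * ((c * b + 1) * n) < \<epsilon>"
    using \<open>0 < \<epsilon>\<close> by (rule order_tendstoD)
  have evX: "\<forall>\<^sub>F z in nhds (X0, Y0). norm (fst z) < a"
    by (rule eventually_norm_less[OF tendsto_pair_nhds(1)]) (simp add: a_def)
  have evY: "\<forall>\<^sub>F z in nhds (X0, Y0). norm (snd z) < b"
    by (rule eventually_norm_less[OF tendsto_pair_nhds(2)]) (simp add: b_def)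
  have evE: "\<forall>\<^sub>F z in nhds (X0, Y0). norm (fst z ** snd z - X0 ** Y0) < 1"
    by (rule eventually_norm_less[OF product_error_tendsto_0]) simp
  from small evX evY evE have "\<forall>\<^sub>F z in nhds (X0, Y0). \<exists>H K.
      norm ((fst z ** snd z - X0 ** Y0) - (fst z ** K + H ** snd z)) \<le> \<epsilon> * norm (fst z ** snd z - X0 ** Y0) \<and>
      norm (H, K) \<le> C * norm (fst z ** snd z - X0 ** Y0) powr (1 / 2)"
  proof eventually_elim
    case (elim z)
    define X where "X = fst z"
    define Y where "Y = snd z"
    define E where "E = X ** Y - M"
    define \<tau> where "\<tau> = sqrt (norm E)"
    have sm: "\<tau> * ((c * b + 1) * n) < \<epsilon>" "norm X \<le> a" "norm Y \<le> b" "norm E \<le> 1"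
      using elim by (simp_all add: \<tau>_def E_def M_def X_def Y_def)
    have \<tau>2: "\<tau>\<^sup>2 = norm E"
      by (simp add: \<tau>_def)
    have "\<exists>H K. norm (E - (X ** K + H ** Y)) \<le> \<epsilon> * norm E \<and> norm (H, K) \<le> C * \<tau>"
    proof (cases "E = 0")
      case True
      then show ?thesis
        by (intro exI[of _ 0]) (simp add: \<tau>_def matrix_mult_zero)
    next
      case False
      then have \<tau>: "0 < \<tau>" "\<tau> \<le> 1"
        using sm by (simp_all add: \<tau>_def)
      obtain S where S: "(X ** transpose X + \<tau>\<^sup>2 *\<^sub>R mat 1) ** S = mat 1"
        using regularized_inverse_exists[OF \<tau>(1)] by blast
      define T where "T = \<tau>\<^sup>2 *\<^sub>R S"
      define K where "K = transpose X ** (S ** E)"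
      define H where "H = T ** X - T ** M ** N ** X"
      have M_eq: "M = X ** Y - E"
        by (simp add: E_def)
      have MNM: "M ** (N ** M) = M"
        using N by (simp add: M_def matrix_mul_assoc)
      have T_E: "E - X ** K = T ** E"
        using regularized_decomposition[OF \<tau>(1) S, of E]
        by (simp add: K_def T_def matrix_mult_scaleR algebra_simps)
      have "T ** E = T ** (X ** Y) - T ** (M ** (N ** (X ** Y - E)))"
        using MNM unfolding M_eq[symmetric] E_def by (simp add: matrix_mult_ring_simps)
      also have "\<dots> = H ** Y + T ** M ** N ** E"
        by (simp add: H_def matrix_mult_ring_simps matrix_mul_assoc)
      finally have err: "E - (X ** K + H ** Y) = T ** M ** N ** E"
        using T_E by (simp add: algebra_simps)
      have TX: "norm (T ** X) \<le> \<tau> * c"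
        using mult_left_mono[OF regularized_residual_self_le[OF \<tau>(1) S], of \<tau>] \<tau>(1)
        by (simp add: T_def matrix_mult_scaleR c_def power2_eq_square mult_ac)
      have TE: "norm (T ** E) \<le> \<tau>\<^sup>2"
        using regularized_residual_le[OF \<tau>(1) S, of E] by (simp add: T_def matrix_mult_scaleR \<tau>2)
      have "norm (T ** M) \<le> norm ((T ** X) ** Y) + norm (T ** E)"
        unfolding M_eq by (simp add: matrix_mult_ring_simps matrix_mul_assoc norm_triangle_ineq4)
      also have "\<dots> \<le> \<tau> * c * b + \<tau>\<^sup>2"
        using norm_le_of_mult[OF TX sm(3)] TE by linarith
      also have "\<tau>\<^sup>2 \<le> \<tau>"
        using \<tau> by (simp add: power2_eq_square mult_left_le)
      finally have TM: "norm (T ** M) \<le> \<tau> * (c * b + 1)"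
        by (simp add: algebra_simps)
      have TMN: "norm (T ** M ** N) \<le> \<tau> * (c * b + 1) * n"
        using norm_le_of_mult[OF TM order_refl, of N] by (simp add: n_def)
      have "norm (T ** M ** N ** E) \<le> \<tau> * (c * b + 1) * n * norm E"
        using norm_le_of_mult[OF TMN order_refl, of E] by simp
      also have "\<dots> \<le> \<epsilon> * norm E"
        using sm(1) by (intro mult_right_mono) (simp_all add: mult_ac)
      finally have "norm (E - (X ** K + H ** Y)) \<le> \<epsilon> * norm E"
        by (simp add: err)
      moreover have "norm (H, K) \<le> C * \<tau>"
      proof -
        have "\<tau> * norm K \<le> \<tau> * \<tau>"
          using regularized_solution_le[OF \<tau>(1) S, of E] by (simp add: K_def \<tau>2[symmetric] power2_eq_square)
        then have "norm K \<le> \<tau>"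
          using \<tau>(1) by simp
        moreover have "norm H \<le> \<tau> * c + \<tau> * (c * b + 1) * n * a"
          unfolding H_def using norm_triangle_ineq4[of "T ** X" "T ** M ** N ** X"] TX
            norm_le_of_mult[OF TMN sm(2)] by linarith
        ultimately show ?thesis
          using norm_Pair_le[of H K] by (simp add: C_def algebra_simps)
      qed
      ultimately show ?thesis
        by blast
    qed
    then show ?case
      by (simp add: X_def Y_def E_def M_def \<tau>_def powr_half_sqrt)
  qed
  then show "\<exists>C>0. \<forall>\<^sub>F (X, Y) in nhds (X0, Y0). \<exists>H K.
        norm ((X ** Y - X0 ** Y0) - (X ** K + H ** Y)) \<le> \<epsilon> * norm (X ** Y - X0 ** Y0) \<and>
        norm (H, K) \<le> C * norm (X ** Y - X0 ** Y0) powr (1 / 2)"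
    using \<open>0 < C\<close> by (intro exI[of _ C]) (simp add: case_prod_unfold)
qed


section \<open>Bounded solutions of the linearized equation\<close>

lemma eventually_norm_diff_mult_less:
  fixes k :: real
  assumes "(f \<longlongrightarrow> l) F" "0 < \<epsilon>"
  shows "\<forall>\<^sub>F z in F. norm (f z - l) * k < \<epsilon>"
proof -
  have "((\<lambda>z. norm (f z - l) * k) \<longlongrightarrow> 0) F"
    using assms(1) by (intro tendsto_mult_left_zero tendsto_norm_zero) (simp add: LIM_zero)
  then show ?thesis
    using assms(2) by (rule order_tendstoD)
qed

text \<open>Here \<open>K = A ** E\<close> suffices: \<open>X ** A\<close> is close to the identity.\<close>

lemma product_error_linearizable_one_if_right_inverse:
  fixes X0 :: "real ^ 'r ^ 'm" and Y0 :: "real ^ 'n ^ 'r"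
  assumes A: "X0 ** A = mat 1"
  shows "product_error_linearizable 1 X0 Y0"
  unfolding product_error_linearizable_def
proof (intro allI impI exI conjI)
  fix \<epsilon> :: real assume "0 < \<epsilon>"
  show "0 < norm A + 1"
    using norm_ge_zero[of A] by linarith
  from eventually_norm_diff_mult_less[OF tendsto_pair_nhds(1) \<open>0 < \<epsilon>\<close>, of X0 "norm A" Y0]
  show "\<forall>\<^sub>F (X, Y) in nhds (X0, Y0). \<exists>H K.
      norm ((X ** Y - X0 ** Y0) - (X ** K + H ** Y)) \<le> \<epsilon> * norm (X ** Y - X0 ** Y0) \<and>
      norm (H, K) \<le> (norm A + 1) * norm (X ** Y - X0 ** Y0) powr 1"
  proof (rule eventually_mono, clarify)
    fix X :: "real ^ 'r ^ 'm" and Y :: "real ^ 'n ^ 'r"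
    assume "norm (fst (X, Y) - X0) * norm A < \<epsilon>"
    then have small: "norm ((X - X0) ** A) \<le> \<epsilon>"
      using norm_matrix_mult_le[of "X - X0" A] by simp
    define E where "E = X ** Y - X0 ** Y0"
    have "E - (X ** (A ** E) + 0 ** Y) = (X0 ** A - X ** A) ** E"
      by (simp add: A matrix_mult_ring_simps matrix_mul_assoc
        matrix_mult_zero)
    also have "\<dots> = - (((X - X0) ** A) ** E)"
      by (simp add: matrix_mult_ring_simps)
    finally have "norm (E - (X ** (A ** E) + 0 ** Y)) \<le> \<epsilon> * norm E"
      using norm_le_of_mult[OF small order_refl, of E] by simp
    moreover have "norm (0 :: real ^ 'r ^ 'm, A ** E) \<le> (norm A + 1) * norm E powr 1"
      using norm_matrix_mult_le[of A E] by (simp add: norm_Pair algebra_simps add_increasing)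
    ultimately show "\<exists>H K. norm (X ** Y - X0 ** Y0 - (X ** K + H ** Y)) \<le> \<epsilon> * norm (X ** Y - X0 ** Y0) \<and>
      norm (H, K) \<le> (norm A + 1) * norm (X ** Y - X0 ** Y0) powr 1"
      unfolding E_def by blast
  qed
qed

lemma product_error_linearizable_one_if_left_inverse:
  fixes X0 :: "real ^ 'r ^ 'm" and Y0 :: "real ^ 'n ^ 'r"
  assumes B: "B ** Y0 = mat 1"
  shows "product_error_linearizable 1 X0 Y0"
  unfolding product_error_linearizable_def
proof (intro allI impI exI conjI)
  fix \<epsilon> :: real assume "0 < \<epsilon>"
  show "0 < norm B + 1"
    using norm_ge_zero[of B] by linarith
  from eventually_norm_diff_mult_less[OF tendsto_pair_nhds(2) \<open>0 < \<epsilon>\<close>, of Y0 "norm B" X0]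
  show "\<forall>\<^sub>F (X, Y) in nhds (X0, Y0). \<exists>H K.
      norm ((X ** Y - X0 ** Y0) - (X ** K + H ** Y)) \<le> \<epsilon> * norm (X ** Y - X0 ** Y0) \<and>
      norm (H, K) \<le> (norm B + 1) * norm (X ** Y - X0 ** Y0) powr 1"
  proof (rule eventually_mono, clarify)
    fix X :: "real ^ 'r ^ 'm" and Y :: "real ^ 'n ^ 'r"
    assume "norm (snd (X, Y) - Y0) * norm B < \<epsilon>"
    then have small: "norm (B ** (Y - Y0)) \<le> \<epsilon>"
      using norm_matrix_mult_le[of B "Y - Y0"] by (simp add: mult.commute)
    define E where "E = X ** Y - X0 ** Y0"
    have "E - (X ** 0 + (E ** B) ** Y) = E ** (B ** Y0 - B ** Y)"
      by (simp add: B matrix_mult_ring_simps matrix_mul_assoc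
        matrix_mult_zero)
    also have "\<dots> = - (E ** (B ** (Y - Y0)))"
      by (simp add: matrix_mult_ring_simps)
    finally have "norm (E - (X ** 0 + (E ** B) ** Y)) \<le> \<epsilon> * norm E"
      using norm_le_of_mult[OF order_refl small, of E] by (simp add: mult.commute)
    moreover have "norm (E ** B, 0 :: real ^ 'n ^ 'r) \<le> (norm B + 1) * norm E powr 1"
      using norm_matrix_mult_le[of E B] by (simp add: norm_Pair algebra_simps add_increasing)
    ultimately show "\<exists>H K. norm (X ** Y - X0 ** Y0 - (X ** K + H ** Y)) \<le> \<epsilon> * norm (X ** Y - X0 ** Y0) \<and>
      norm (H, K) \<le> (norm B + 1) * norm (X ** Y - X0 ** Y0) powr 1"
      unfolding E_def by blast
  qed
qed

text \<open>For commuting projections \<open>A ** X0\<close> and \<open>Y0 ** B\<close>, the hypothesis \<open>kernel\<close> says that the kernel of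
  \<open>X0\<close> lies in the range of \<open>Y0\<close>. With
  \<open>J = mat 1 + (X - X0) ** A\<close>, which is close to the identity, its inverse \<open>S\<close>, and
  \<open>e = (mat 1 - X0 ** A) ** S\<close>, the choice \<open>K = A ** S ** E\<close> leaves the residual \<open>e ** E\<close>. Again,
  as in \<open>product_error_linearizable_half\<close>,
  \<open>e ** E = H ** Y + e ** M ** N ** E\<close> for \<open>H = e ** X - e ** M ** N ** X\<close>, and \<open>e ** M\<close> is small because
  \<open>e\<close> is close to a matrix that annihilates \<open>X0\<close>.

  The point is the bound of \<open>H\<close> by \<open>H ** Y\<close>, hence by \<open>E\<close>. It holds if the rows of \<open>H\<close> are almost
  supported on the range of \<open>Y0\<close>, that is, if \<open>H ** R\<close> is small relative to \<open>H\<close> for the complementary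
  projection \<open>R = mat 1 - Y0 ** B\<close>. Now \<open>e\<close> is chosen to annihilate \<open>X ** A ** X0\<close> exactly, and \<open>kernel\<close>
  says \<open>R = A ** X0 ** R\<close>, so \<open>e ** X ** R = 0\<close>; what remains of \<open>H ** R\<close> is \<open>e ** M\<close> times a factor of
  order \<open>X - X0\<close>, and \<open>e ** M\<close> is bounded by a multiple of \<open>H\<close>.\<close>

lemma product_error_linearizable_one_if_kernel_in_range:
  fixes X0 :: "real ^ 'r ^ 'm" and Y0 :: "real ^ 'n ^ 'r"
  assumes A: "X0 ** A ** X0 = X0"
    and B: "B ** Y0 ** B = B"
    and MNM: "(X0 ** Y0) ** (B ** A) ** (X0 ** Y0) = X0 ** Y0"
    and kernel: "(mat 1 - A ** X0) ** (mat 1 - Y0 ** B) = 0"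
  shows "product_error_linearizable 1 X0 Y0"
  unfolding product_error_linearizable_def
proof (intro allI impI)
  fix \<epsilon> :: real assume "0 < \<epsilon>"
  define M where "M = X0 ** Y0"
  define N where "N = B ** A"
  define R where "R = mat 1 - Y0 ** B"
  define F where "F = mat 1 - X0 ** A"
  define j where "j = norm (mat 1 :: real ^ 'm ^ 'm)"
  define e0 where "e0 = norm F * (2 * j)"
  define C where "C = 1 + 2 * norm B * (e0 + \<epsilon>) + 2 * norm A * j"
  have "0 \<le> j" "0 \<le> e0"
    by (simp_all add: j_def e0_def)
  then have "0 < C"
    unfolding C_def using \<open>0 < \<epsilon>\<close>
    by (intro add_pos_nonneg mult_nonneg_nonneg add_nonneg_nonneg) simp_all
  have FX0: "F ** X0 = 0"
    by (simp add: F_def matrix_mult_ring_simps A)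
  have X0AM: "X0 ** (A ** M) = M"
    by (simp add: M_def matrix_mul_assoc A)
  have MNM': "M ** (N ** M) = M"
    using MNM by (simp add: M_def N_def matrix_mul_assoc)
  have R_eq: "R = A ** (X0 ** R)"
    using kernel unfolding R_def[symmetric] by (simp add: matrix_mult_ring_simps matrix_mul_assoc)
  have BR: "B ** R = 0"
    by (simp add: R_def matrix_mult_ring_simps matrix_mul_assoc B)
  have NX0R: "N ** (X0 ** R) = 0"
    using R_eq BR by (simp add: N_def matrix_mul_assoc[symmetric])
  note evX = eventually_norm_diff_mult_less[OF tendsto_pair_nhds(1)[of X0 Y0]]
  note evY = eventually_norm_diff_mult_less[OF tendsto_pair_nhds(2)[of Y0 X0]]
  have ev1: "\<forall>\<^sub>F z in nhds (X0, Y0). norm (fst z - X0) * norm A < 1 / 2"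
    by (rule evX) simp
  have ev2: "\<forall>\<^sub>F z in nhds (X0, Y0). norm (fst z - X0) * (e0 * norm A * norm M * norm N) < \<epsilon>"
    using \<open>0 < \<epsilon>\<close> by (rule evX)
  have ev3: "\<forall>\<^sub>F z in nhds (X0, Y0). norm (fst z - X0) * (norm A * norm M * norm N) < 1 / 2"
    by (rule evX) simp
  have ev4: "\<forall>\<^sub>F z in nhds (X0, Y0). norm (fst z - X0) * (2 * norm A * norm M * norm N * norm R) < 1 / 4"
    by (rule evX) simp
  have ev5: "\<forall>\<^sub>F z in nhds (X0, Y0). norm (snd z - Y0) * norm B < 1 / 4"
    by (rule evY) simp
  from ev1 ev2 ev3 ev4 ev5 have "\<forall>\<^sub>F z in nhds (X0, Y0). \<exists>H K.
      norm ((fst z ** snd z - X0 ** Y0) - (fst z ** K + H ** snd z)) \<le> \<epsilon> * norm (fst z ** snd z - X0 ** Y0) \<and>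
      norm (H, K) \<le> C * norm (fst z ** snd z - X0 ** Y0) powr 1"
  proof eventually_elim
    case (elim z)
    define X where "X = fst z"
    define Y where "Y = snd z"
    define E where "E = X ** Y - M"
    define D where "D = X - X0"
    have s1: "norm D * norm A \<le> 1 / 2"
      and s2: "norm D * (e0 * norm A * norm M * norm N) \<le> \<epsilon>"
      and s3: "norm D * (norm A * norm M * norm N) \<le> 1 / 2"
      and s4: "norm D * (2 * norm A * norm M * norm N * norm R) \<le> 1 / 4"
      and s5: "norm (Y - Y0) * norm B \<le> 1 / 4"
      using elim by (simp_all add: D_def X_def Y_def)
    have X_eq: "X = X0 + D"
      by (simp add: D_def)
    define J where "J = mat 1 + D ** A"
    have J_lower: "1 / 2 * norm Z \<le> norm (J ** Z)" for Z :: "real ^ 'm ^ 'm"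
    proof -
      have "J ** Z = Z + (D ** A) ** Z"
        by (simp add: J_def matrix_mult_ring_simps)
      moreover have "norm ((D ** A) ** Z) \<le> 1 / 2 * norm Z"
        using norm_le_of_mult[OF order_trans[OF norm_matrix_mult_le s1] order_refl] .
      ultimately show ?thesis
        using norm_diff_ineq[of Z "(D ** A) ** Z"] by simp
    qed
    obtain S where S: "J ** S = mat 1"
      using right_inverse_exists_of_lower_bound[OF _ J_lower] by auto
    have S_norm: "norm S \<le> 2 * j"
      using J_lower[of S] by (simp add: S j_def)
    have SJ: "S ** J = mat 1"
      using S matrix_left_right_inverse by blast
    define e where "e = F ** S"
    define K where "K = A ** (S ** E)"
    define H where "H = e ** X - e ** M ** N ** X"
    have e_norm: "norm e \<le> e0"
      unfolding e_def e0_def by (rule norm_le_of_mult[OF order_refl S_norm])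
    have JX0: "J ** X0 = X ** (A ** X0)"
      using A by (simp add: J_def X_eq matrix_mult_ring_simps matrix_mul_assoc)
    \<comment> \<open>the correction \<open>J\<close> maps \<open>X0\<close> to \<open>X ** A ** X0\<close>, and \<open>mat 1 - X0 ** A\<close> annihilates \<open>X0\<close>\<close>
    have eXAX0: "e ** (X ** (A ** X0)) = 0"
    proof -
      have "e ** (X ** (A ** X0)) = F ** ((S ** J) ** X0)"
        unfolding e_def JX0[symmetric] by (simp only: matrix_mul_assoc)
      then show ?thesis
        by (simp add: SJ FX0)
    qed
    have XK: "E - X ** K = e ** E"
    proof -
      have "E - X ** K = (J ** S) ** E - X ** (A ** (S ** E))"
        by (simp add: S K_def)
      also have "\<dots> = e ** E"
        by (simp add: J_def X_eq e_def F_def matrix_mult_ring_simps matrix_mul_assoc)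
      finally show ?thesis .
    qed
    have M_eq: "M = X ** Y - E"
      by (simp add: E_def)
    have eE: "e ** E = H ** Y + e ** M ** N ** E"
    proof -
      have "e ** E = e ** (X ** Y) - e ** (M ** (N ** (X ** Y - E)))"
        using MNM' unfolding M_eq[symmetric] E_def by (simp add: matrix_mult_ring_simps)
      then show ?thesis
        by (simp add: H_def matrix_mult_ring_simps matrix_mul_assoc)
    qed
    have eM: "e ** M = - (e ** D ** A ** M)"
    proof -
      have "e ** M + e ** D ** A ** M = e ** (X0 ** (A ** M)) + e ** D ** A ** M"
        by (simp only: X0AM)
      also have "\<dots> = e ** (X ** (A ** X0)) ** Y0"
        by (simp add: X_eq M_def matrix_mult_ring_simps matrix_mul_assoc)
      finally have "e ** M + e ** D ** A ** M = e ** (X ** (A ** X0)) ** Y0" .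
      then show ?thesis
        by (simp add: eXAX0 matrix_mult_zero eq_neg_iff_add_eq_0)
    qed
    have eM_norm: "norm (e ** M) \<le> e0 * norm D * norm A * norm M"
      unfolding eM norm_minus_cancel
      by (intro norm_le_of_mult e_norm order_refl)
    have err_norm: "norm (e ** M ** N ** E) \<le> \<epsilon> * norm E"
    proof -
      have "norm (e ** M ** N ** E) \<le> e0 * norm D * norm A * norm M * norm N * norm E"
        by (intro norm_le_of_mult eM_norm order_refl)
      also have "\<dots> \<le> \<epsilon> * norm E"
        using s2 by (intro mult_right_mono) (simp_all add: mult_ac)
      finally show ?thesis .
    qed
    \<comment> \<open>multiplying the definition of \<open>H\<close> by \<open>A ** M\<close> recovers \<open>e ** M\<close> up to a fraction of it\<close>
    have eM_H: "norm (e ** M) \<le> 2 * norm H * norm A * norm M"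
    proof -
      have "e ** M = - (H ** A ** M) - e ** M ** N ** D ** A ** M"
      proof -
        have "H ** A ** M = e ** (X ** (A ** X0)) ** Y0 - e ** M ** N ** X ** A ** M"
          by (simp add: H_def M_def matrix_mult_ring_simps matrix_mul_assoc)
        also have "\<dots> = - (e ** M ** N ** X0 ** A ** M + e ** M ** N ** D ** A ** M)"
          unfolding eXAX0 by (simp add: matrix_mult_zero X_eq matrix_mult_ring_simps)
        also have "e ** M ** N ** X0 ** A ** M = e ** (M ** (N ** (X0 ** (A ** M))))"
          by (simp add: matrix_mul_assoc)
        also have "\<dots> = e ** M"
          by (simp add: X0AM MNM')
        finally show ?thesis
          by simp
      qed
      then have "norm (e ** M) \<le> norm (H ** A ** M) + norm (e ** M ** N ** D ** A ** M)"
        using norm_triangle_ineq4[of "- (H ** A ** M)" "e ** M ** N ** D ** A ** M"] by simp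
      also have "norm (H ** A ** M) \<le> norm H * norm A * norm M"
        by (intro norm_le_of_mult order_refl)
      also have "norm (e ** M ** N ** D ** A ** M) \<le> norm (e ** M) * norm N * norm D * norm A * norm M"
        by (intro norm_le_of_mult order_refl)
      also have "\<dots> \<le> norm (e ** M) * (1 / 2)"
        using mult_left_mono[OF s3, of "norm (e ** M)"] by (simp add: mult_ac)
      finally show ?thesis
        by simp
    qed
    have HR_norm: "norm (H ** R) \<le> 1 / 4 * norm H"
    proof -
      have "H ** R = e ** (X ** R) - e ** M ** (N ** (X0 ** R)) - e ** M ** N ** D ** R"
        by (simp add: H_def X_eq matrix_mult_ring_simps matrix_mul_assoc)
      also have "e ** (X ** R) = e ** (X ** (A ** X0)) ** R"
        by (subst R_eq) (simp add: matrix_mul_assoc)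
      finally have "H ** R = - (e ** M ** N ** D ** R)"
        by (simp add: eXAX0 matrix_mult_zero NX0R)
      then have "norm (H ** R) \<le> 2 * norm H * norm A * norm M * norm N * norm D * norm R"
        using norm_le_of_mult[OF norm_le_of_mult[OF norm_le_of_mult[OF eM_H order_refl] order_refl] order_refl]
        by simp
      also have "\<dots> \<le> 1 / 4 * norm H"
        using mult_left_mono[OF s4, of "norm H"] by (simp add: mult_ac)
      finally show ?thesis .
    qed
    have HY_norm: "norm (H ** Y) \<le> (e0 + \<epsilon>) * norm E"
    proof -
      have "H ** Y = e ** E - e ** M ** N ** E"
        by (simp add: eE)
      then have "norm (H ** Y) \<le> norm (e ** E) + norm (e ** M ** N ** E)"
        by (simp add: norm_triangle_ineq4)
      then show ?thesis
        using norm_le_of_mult[OF e_norm order_refl, of E] err_norm by (simp add: algebra_simps)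
    qed
    have H_norm: "norm H \<le> 2 * norm B * (e0 + \<epsilon>) * norm E"
    proof -
      have "H = H ** Y ** B - H ** ((Y - Y0) ** B) + H ** R"
        by (simp add: R_def matrix_mult_ring_simps matrix_mul_assoc)
      then have "norm H = norm (H ** Y ** B - H ** ((Y - Y0) ** B) + H ** R)"
        by (rule arg_cong)
      then have "norm H \<le> norm (H ** Y ** B) + norm (H ** ((Y - Y0) ** B)) + norm (H ** R)"
        using norm_triangle_ineq[of "H ** Y ** B - H ** ((Y - Y0) ** B)" "H ** R"]
          norm_triangle_ineq4[of "H ** Y ** B" "H ** ((Y - Y0) ** B)"] by linarith
      also have "norm (H ** Y ** B) \<le> (e0 + \<epsilon>) * norm E * norm B"
        by (intro norm_le_of_mult HY_norm order_refl)
      also have "norm (H ** ((Y - Y0) ** B)) \<le> norm H * (1 / 4)"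
        by (intro norm_le_of_mult order_refl order_trans[OF norm_matrix_mult_le s5])
      finally have "norm H \<le> 2 * ((e0 + \<epsilon>) * norm E * norm B)"
        using HR_norm by simp
      then show ?thesis
        by (simp add: mult_ac)
    qed
    have "norm K \<le> norm A * (2 * j * norm E)"
      unfolding K_def by (intro norm_le_of_mult order_refl S_norm)
    moreover have "C * norm E = norm E + 2 * norm B * (e0 + \<epsilon>) * norm E + norm A * (2 * j * norm E)"
      by (simp add: C_def algebra_simps)
    ultimately have "norm (H, K) \<le> C * norm E"
      using H_norm norm_Pair_le[of H K] norm_ge_zero[of E] by linarith
    moreover have "norm (E - (X ** K + H ** Y)) \<le> \<epsilon> * norm E"
    proof -
      have "E - (X ** K + H ** Y) = (E - X ** K) - H ** Y"
        by simp
      also have "\<dots> = e ** M ** N ** E"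
        unfolding XK eE by simp
      finally show ?thesis
        using err_norm by simp
    qed
    ultimately show ?case
      unfolding X_def Y_def E_def M_def by auto
  qed
  then show "\<exists>C>0. \<forall>\<^sub>F (X, Y) in nhds (X0, Y0). \<exists>H K.
        norm ((X ** Y - X0 ** Y0) - (X ** K + H ** Y)) \<le> \<epsilon> * norm (X ** Y - X0 ** Y0) \<and>
        norm (H, K) \<le> C * norm (X ** Y - X0 ** Y0) powr 1"
    using \<open>0 < C\<close> by (intro exI[of _ C]) (simp add: case_prod_unfold)
qed


section \<open>The Clarke subdifferential of a convex function of a product\<close>

text \<open>Moving from \<open>(X, Y)\<close> by \<open>- t *\<^sub>R (H, K)\<close> changes the product to a convex combination with weight \<open>t\<close> of
  \<open>X ** Y\<close> and a point that tends to \<open>X ** Y - (X ** K + H ** Y)\<close>, so convexity bounds the difference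
  quotient along this curve.\<close>

lemma gradient_product_ge_decrease:
  fixes h :: "real ^ 'n ^ 'm \<Rightarrow> real" and X H :: "real ^ 'r ^ 'm" and Y K :: "real ^ 'n ^ 'r"
  assumes convex: "convex_on UNIV h" and cont: "continuous_on UNIV h"
    and grad: "GDERIV (\<lambda>(X, Y). h (X ** Y)) (X, Y) :> v"
  shows "h (X ** Y) - h (X ** Y - (X ** K + H ** Y)) \<le> (H, K) \<bullet> v"
proof -
  define f :: "(real ^ 'r ^ 'm) \<times> (real ^ 'n ^ 'r) \<Rightarrow> real" where "f = (\<lambda>(X, Y). h (X ** Y))"
  define \<phi> where "\<phi> t = f ((X, Y) - t *\<^sub>R (H, K))" for t :: real
  define q where "q t = h (X ** Y - (X ** K + H ** Y) + t *\<^sub>R (H ** K))" for t :: real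
  have "(f has_derivative (\<lambda>w. w \<bullet> v)) (at ((X, Y) - 0 *\<^sub>R (H, K)))"
    using grad by (simp add: gderiv_def f_def)
  then have "(\<phi> has_derivative (\<lambda>t. (- (t *\<^sub>R (H, K))) \<bullet> v)) (at 0)"
    unfolding \<phi>_def
    by (intro has_derivative_compose[where g = f and f = "\<lambda>t. (X, Y) - t *\<^sub>R (H, K)"])
      (auto intro!: derivative_eq_intros)
  then have "DERIV \<phi> 0 :> - ((H, K) \<bullet> v)"
    unfolding has_field_derivative_def
    by (rule has_derivative_eq_rhs) (simp add: fun_eq_iff mult.commute del: scaleR_Pair uminus_Pair)
  then have "((\<lambda>t. (\<phi> t - \<phi> 0) / t) \<longlongrightarrow> - ((H, K) \<bullet> v)) (at_right 0)"
    by (rule tendsto_mono[OF at_le[OF subset_UNIV], of "\<lambda>t. (\<phi> t - \<phi> 0) / t", OF DERIV_D[of \<phi> _ 0, unfolded add_0]])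
  moreover have "((\<lambda>t. q t - \<phi> 0) \<longlongrightarrow> q 0 - \<phi> 0) (at_right 0)"
  proof -
    have "isCont q 0"
      unfolding q_def using cont
      by (intro continuous_at_compose[unfolded o_def, of 0 _ h] continuous_intros)
        (simp add: continuous_on_eq_continuous_at)
    then have "(q \<longlongrightarrow> q 0) (at_right 0)"
      unfolding isCont_def by (rule tendsto_mono[OF at_le[OF subset_UNIV]])
    then show ?thesis
      by (intro tendsto_intros)
  qed
  moreover have "\<forall>\<^sub>F t in at_right 0. (\<phi> t - \<phi> 0) / t \<le> q t - \<phi> 0"
    using eventually_at_right_less eventually_at_right_real[of 0 1, OF zero_less_one]
  proof eventually_elim
    case (elim t)
    then have t: "0 < t" "t < 1"
      by auto
    \<comment> \<open>the curve point as a convex combination of \<open>X ** Y\<close> and the argument of \<open>h\<close> in \<open>q t\<close>\<close>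
    have "(X - t *\<^sub>R H) ** (Y - t *\<^sub>R K)
        = (1 - t) *\<^sub>R (X ** Y) + t *\<^sub>R (X ** Y - (X ** K + H ** Y) + t *\<^sub>R (H ** K))"
      by (simp add: matrix_mult_ring_simps matrix_mult_scaleR algebra_simps)
    then have "\<phi> t = h ((1 - t) *\<^sub>R (X ** Y) + t *\<^sub>R (X ** Y - (X ** K + H ** Y) + t *\<^sub>R (H ** K)))"
      by (simp add: \<phi>_def f_def)
    also have "\<dots> \<le> (1 - t) * \<phi> 0 + t * q t"
      using convex_onD[OF convex, of t] t by (simp add: \<phi>_def f_def q_def)
    finally have "\<phi> t - \<phi> 0 \<le> (q t - \<phi> 0) * t"
      by (simp add: algebra_simps)
    then show ?case
      using t by (simp add: divide_le_eq)
  qed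
  ultimately have "- ((H, K) \<bullet> v) \<le> q 0 - \<phi> 0"
    by (intro tendsto_le[OF trivial_limit_at_right_real])
  then show ?thesis
    by (simp add: q_def \<phi>_def f_def)
qed

text \<open>The inequality is linear in \<open>v\<close> and its left-hand side is continuous in \<open>(X, Y)\<close>, so it passes from
  gradients to their limits and to convex hulls.\<close>

lemma clarke_product_ge_decrease:
  fixes h :: "real ^ 'n ^ 'm \<Rightarrow> real" and X H :: "real ^ 'r ^ 'm" and Y K :: "real ^ 'n ^ 'r"
  assumes convex: "convex_on UNIV h" and cont: "continuous_on UNIV h"
    and v: "v \<in> clarke_subdifferential (\<lambda>(X, Y). h (X ** Y)) (X, Y)"
  shows "h (X ** Y) - h (X ** Y - (X ** K + H ** Y)) \<le> (H, K) \<bullet> v"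
proof -
  let ?f = "\<lambda>(X, Y). h (X ** Y)" and ?c = "h (X ** Y) - h (X ** Y - (X ** K + H ** Y))"
  have "clarke_subdifferential ?f (X, Y) \<subseteq> {v. (H, K) \<bullet> v \<ge> ?c}"
    unfolding clarke_subdifferential_def
  proof (intro hull_minimal convex_halfspace_ge subsetI CollectI, elim CollectE exE conjE)
    fix u y d
    assume y: "y \<longlonglongrightarrow> (X, Y)" and grad: "\<forall>k. GDERIV ?f (y k) :> d k" and d: "d \<longlonglongrightarrow> u"
    define x where "x k = fst (y k)" for k
    define z where "z k = snd (y k)" for k
    have x: "x \<longlonglongrightarrow> X" and z: "z \<longlonglongrightarrow> Y"
      using tendsto_fst[OF y] tendsto_snd[OF y] by (simp_all add: x_def[abs_def] z_def[abs_def])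
    have le: "h (x k ** z k) - h (x k ** z k - (x k ** K + H ** z k)) \<le> (H, K) \<bullet> d k" for k
      using gradient_product_ge_decrease[OF convex cont, of "x k" "z k" "d k"] grad
      by (simp add: x_def z_def)
    have lim: "(\<lambda>k. h (a k)) \<longlonglongrightarrow> h l" if "a \<longlonglongrightarrow> l" for a l
      using continuous_on_tendsto_compose[OF cont that] by simp
    have "(\<lambda>k. h (x k ** z k) - h (x k ** z k - (x k ** K + H ** z k))) \<longlonglongrightarrow> ?c"
      by (intro tendsto_diff lim tendsto_add tendsto_matrix_mult x z tendsto_const)
    moreover have "(\<lambda>k. (H, K) \<bullet> d k) \<longlonglongrightarrow> (H, K) \<bullet> u"
      by (intro tendsto_intros d)
    ultimately show "?c \<le> (H, K) \<bullet> u"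
      using le by (intro LIMSEQ_le) auto
  qed
  then show ?thesis
    using v by auto
qed


section \<open>Kurdyka-Lojasiewicz exponents of convex functions of a product\<close>

text \<open>If the relative error of the linearized equation is \<open>\<epsilon>\<close>, then \<open>h\<close> exceeds its value at \<open>X0 ** Y0\<close> by
  at most \<open>L * (\<epsilon> * norm E) powr \<kappa>\<close> after the step. The value of \<open>\<epsilon>\<close> makes this half of
  \<open>\<mu> * norm E powr \<kappa>\<close>, hence at most half of the gap \<open>\<psi>\<close>. The step therefore gains \<open>\<psi> / 2\<close>, and its
  length is at most a multiple of \<open>\<psi> powr (\<theta> / \<kappa>)\<close>.\<close>

theorem has_KL_exponent_product:
  fixes h :: "real ^ 'n ^ 'm \<Rightarrow> real" and X0 :: "real ^ 'r ^ 'm" and Y0 :: "real ^ 'n ^ 'r"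
  defines "f \<equiv> \<lambda>(X, Y). h (X ** Y)"
  assumes convex: "convex_on UNIV h" and cont: "continuous_on UNIV h"
    and lip: "locally_lipschitz f"
    and nonempty: "\<And>z. clarke_subdifferential f z \<noteq> {}"
    and pos: "0 < \<mu>" "0 < L" "0 < \<theta>" "\<theta> \<le> \<kappa>"
    and lower: "\<And>(X :: real ^ 'r ^ 'm) Y. \<mu> * norm (X ** Y - X0 ** Y0) powr \<kappa> \<le> h (X ** Y) - h (X0 ** Y0)"
    and upper: "\<And>E. h (X0 ** Y0 + E) - h (X0 ** Y0) \<le> L * norm E powr \<kappa>"
    and solvable: "product_error_linearizable \<theta> X0 Y0"
  shows "has_KL_exponent f (1 - \<theta> / \<kappa>) (X0, Y0)"
proof -
  define M where "M = X0 ** Y0"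
  define \<epsilon> where "\<epsilon> = (\<mu> / (2 * L)) powr (1 / \<kappa>)"
  have "0 < \<kappa>"
    using pos by linarith
  have "0 < \<epsilon>"
    using pos by (simp add: \<epsilon>_def)
  have \<epsilon>_powr: "\<epsilon> powr \<kappa> = \<mu> / (2 * L)"
    using pos \<open>0 < \<kappa>\<close> by (simp add: \<epsilon>_def powr_powr)
  obtain C where "0 < C" and ev: "\<forall>\<^sub>F (X, Y) in nhds (X0, Y0). \<exists>H K.
      norm ((X ** Y - M) - (X ** K + H ** Y)) \<le> \<epsilon> * norm (X ** Y - M) \<and>
      norm (H, K) \<le> C * norm (X ** Y - M) powr \<theta>"
    using solvable[unfolded product_error_linearizable_def, rule_format, OF \<open>0 < \<epsilon>\<close>]
    unfolding M_def by blast
  obtain \<rho> where "0 < \<rho>" and ball: "\<forall>z. dist z (X0, Y0) < \<rho> \<longrightarrow> (case z of (X, Y) \<Rightarrow> \<exists>H K.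
      norm ((X ** Y - M) - (X ** K + H ** Y)) \<le> \<epsilon> * norm (X ** Y - M) \<and>
      norm (H, K) \<le> C * norm (X ** Y - M) powr \<theta>)"
    using ev unfolding eventually_nhds_metric by blast
  have \<rho>: "\<exists>H K. norm ((X ** Y - M) - (X ** K + H ** Y)) \<le> \<epsilon> * norm (X ** Y - M) \<and>
      norm (H, K) \<le> C * norm (X ** Y - M) powr \<theta>" if "dist (X, Y) (X0, Y0) < \<rho>" for X Y
    using spec[OF ball, of "(X, Y)"] that by simp
  define c where "c = \<mu> powr (\<theta> / \<kappa>) / (2 * C)"
  have "0 < c"
    using pos \<open>0 < C\<close> by (simp add: c_def)
  have bound: "c * (f (X, Y) - f (X0, Y0)) powr (1 - \<theta> / \<kappa>) \<le> norm v"
    if XY: "dist (X, Y) (X0, Y0) < \<rho>" and gap: "0 < f (X, Y) - f (X0, Y0)"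
      and v: "v \<in> clarke_subdifferential f (X, Y)" for X Y v
  proof -
    define E where "E = X ** Y - M"
    define \<psi> where "\<psi> = f (X, Y) - f (X0, Y0)"
    have \<psi>: "\<psi> = h (X ** Y) - h M" "0 < \<psi>"
      using gap by (simp_all add: \<psi>_def f_def M_def)
    have growth: "\<mu> * norm E powr \<kappa> \<le> \<psi>"
      using lower[of X Y] by (simp add: \<psi> E_def M_def)
    obtain H K where err: "norm (E - (X ** K + H ** Y)) \<le> \<epsilon> * norm E"
      and size: "norm (H, K) \<le> C * norm E powr \<theta>"
      using \<rho>[OF XY] unfolding E_def by blast
    have "h (X ** Y - (X ** K + H ** Y)) - h M \<le> L * norm (E - (X ** K + H ** Y)) powr \<kappa>"
      using upper[of "E - (X ** K + H ** Y)"] by (simp add: E_def M_def algebra_simps)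
    also have "\<dots> \<le> L * (\<epsilon> * norm E) powr \<kappa>"
      using err pos \<open>0 < \<kappa>\<close> by (intro mult_left_mono powr_mono2) auto
    also have "\<dots> = \<mu> * norm E powr \<kappa> / 2"
      using pos \<open>0 < \<epsilon>\<close> by (simp add: powr_mult \<epsilon>_powr)
    finally have "\<psi> / 2 \<le> h (X ** Y) - h (X ** Y - (X ** K + H ** Y))"
      using growth \<psi>(1) by linarith
    also have "\<dots> \<le> (H, K) \<bullet> v"
      using clarke_product_ge_decrease[OF convex cont] v unfolding f_def by blast
    also have "\<dots> \<le> norm (H, K) * norm v"
      by (rule norm_cauchy_schwarz)
    also have "\<dots> \<le> C * norm E powr \<theta> * norm v"
      using size by (rule mult_right_mono) simp
    also have "norm E powr \<theta> \<le> (\<psi> / \<mu>) powr (\<theta> / \<kappa>)"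
    proof -
      have "norm E powr \<theta> = (norm E powr \<kappa>) powr (\<theta> / \<kappa>)"
        using \<open>0 < \<kappa>\<close> by (simp add: powr_powr)
      also have "\<dots> \<le> (\<psi> / \<mu>) powr (\<theta> / \<kappa>)"
        using growth pos \<open>0 < \<kappa>\<close> by (intro powr_mono2) (simp_all add: field_simps)
      finally show ?thesis .
    qed
    finally have "\<psi> / 2 \<le> C * (\<psi> / \<mu>) powr (\<theta> / \<kappa>) * norm v"
      using \<open>0 < C\<close> by (simp add: mult_left_mono mult_right_mono)
    moreover have "\<psi> = \<psi> powr (1 - \<theta> / \<kappa>) * \<psi> powr (\<theta> / \<kappa>)"
      using \<psi>(2) by (simp add: powr_add[symmetric])
    ultimately have "\<psi> powr (\<theta> / \<kappa>) * \<psi> powr (1 - \<theta> / \<kappa>) * \<mu> powr (\<theta> / \<kappa>)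
        \<le> \<psi> powr (\<theta> / \<kappa>) * (2 * C * norm v)"
      using pos \<psi>(2) by (simp add: powr_divide field_simps)
    then have "\<psi> powr (1 - \<theta> / \<kappa>) * \<mu> powr (\<theta> / \<kappa>) \<le> 2 * C * norm v"
      using \<psi>(2) by (simp add: mult.assoc)
    then show ?thesis
      using \<open>0 < C\<close> by (simp add: c_def \<psi>_def[symmetric] field_simps)
  qed
  have "c * (f z - f (X0, Y0)) powr (1 - \<theta> / \<kappa>) \<le> infdist 0 (clarke_subdifferential f z)"
    if "z \<in> ball (X0, Y0) \<rho>" "0 < f z - f (X0, Y0)" for z
    unfolding infdist_notempty[OF nonempty]
  proof (rule cINF_greatest[OF nonempty])
    fix v assume "v \<in> clarke_subdifferential f z"
    then show "c * (f z - f (X0, Y0)) powr (1 - \<theta> / \<kappa>) \<le> dist 0 v"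
      using bound[of "fst z" "snd z" v] that by (simp add: dist_commute)
  qed
  moreover have "0 \<le> 1 - \<theta> / \<kappa>" "1 - \<theta> / \<kappa> < 1"
    using pos \<open>0 < \<kappa>\<close> by simp_all
  ultimately show ?thesis
    unfolding has_KL_exponent_def using lip \<open>0 < \<rho>\<close> \<open>0 < c\<close>
    by (intro conjI exI[of _ \<rho>] exI[of _ 1] exI[of _ c]) simp_all
qed


section \<open>Lipschitz bounds and existence of Clarke subgradients\<close>

lemma has_derivative_matrix_product:
  fixes z :: "(real ^ 'r ^ 'm) \<times> (real ^ 'n ^ 'r)"
  shows "((\<lambda>z. fst z ** snd z) has_derivative (\<lambda>w. fst z ** snd w + fst w ** snd z)) (at z)"
  by (rule bounded_bilinear.FDERIV[OF bounded_bilinear_matrix_mult])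
    (auto intro!: derivative_eq_intros)

lemma locally_lipschitz_product:
  fixes h :: "real ^ 'n ^ 'm \<Rightarrow> real"
  assumes "\<And>R. 0 \<le> R \<Longrightarrow> \<exists>L. L-lipschitz_on (cball 0 R) h"
  shows "locally_lipschitz (\<lambda>(X :: real ^ 'r ^ 'm, Y). h (X ** Y))"
  unfolding locally_lipschitz_def
proof (intro allI, clarify)
  fix X0 :: "real ^ 'r ^ 'm" and Y0 :: "real ^ 'n ^ 'r"
  define a where "a = norm X0 + 1"
  define b where "b = norm Y0 + 1"
  have ab: "0 \<le> a" "0 \<le> b"
    by (simp_all add: a_def b_def)
  obtain L where L: "L-lipschitz_on (cball 0 (a * b)) h"
    using assms[of "a * b"] ab by auto
  have "0 \<le> L"
    using L by (rule lipschitz_on_nonneg)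
  have in_ball: "norm X \<le> a \<and> norm Y \<le> b" if "(X, Y) \<in> ball (X0, Y0) 1" for X Y
  proof -
    have "dist (X0, Y0) (X, Y) < 1"
      using that by simp
    then have "norm (X - X0) < 1" "norm (Y - Y0) < 1"
      using dist_fst_le[of "(X0, Y0)" "(X, Y)"] dist_snd_le[of "(X0, Y0)" "(X, Y)"]
      by (simp_all add: dist_norm norm_minus_commute)
    then show ?thesis
      using norm_triangle_sub[of X X0] norm_triangle_sub[of Y Y0] by (simp add: a_def b_def)
  qed
  have "(L * (a + b))-lipschitz_on (ball (X0, Y0) 1) (\<lambda>(X, Y). h (X ** Y))"
  proof (rule lipschitz_onI, clarify)
    fix X Y X' Y'
    assume "(X, Y) \<in> ball (X0, Y0) 1" "(X', Y') \<in> ball (X0, Y0) 1"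
    then have bounds: "norm X \<le> a" "norm Y \<le> b" "norm X' \<le> a" "norm Y' \<le> b"
      using in_ball by blast+
    have "dist (h (X ** Y)) (h (X' ** Y')) \<le> L * dist (X ** Y) (X' ** Y')"
      using norm_le_of_mult[OF bounds(1,2)] norm_le_of_mult[OF bounds(3,4)]
      by (intro lipschitz_onD[OF L]) simp_all
    also have "dist (X ** Y) (X' ** Y') \<le> (a + b) * dist (X, Y) (X', Y')"
    proof -
      have "X ** Y - X' ** Y' = X ** (Y - Y') + (X - X') ** Y'"
        by (simp add: matrix_mult_ring_simps)
      then have "dist (X ** Y) (X' ** Y') \<le> norm (X ** (Y - Y')) + norm ((X - X') ** Y')"
        by (simp add: dist_norm norm_triangle_ineq)
      also have "norm (X ** (Y - Y')) \<le> a * dist (X, Y) (X', Y')"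
        using dist_snd_le[of "(X, Y)" "(X', Y')"]
        by (intro norm_le_of_mult bounds) (simp add: dist_norm)
      also have "norm ((X - X') ** Y') \<le> dist (X, Y) (X', Y') * b"
        using dist_fst_le[of "(X, Y)" "(X', Y')"]
        by (intro norm_le_of_mult bounds) (simp add: dist_norm)
      finally show ?thesis
        by (simp add: algebra_simps)
    qed
    finally show "dist (h (X ** Y)) (h (X' ** Y')) \<le> L * (a + b) * dist (X, Y) (X', Y')"
      using \<open>0 \<le> L\<close> by (simp add: mult_left_mono mult.assoc)
  next
    show "0 \<le> L * (a + b)"
      using \<open>0 \<le> L\<close> ab by simp
  qed
  then show "\<exists>\<epsilon>>0. \<exists>L. L-lipschitz_on (ball (X0, Y0) \<epsilon>) (\<lambda>(X, Y). h (X ** Y))"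
    using zero_less_one by blast
qed

lemma gradient_norm_le_lipschitz_constant:
  fixes f :: "'a::euclidean_space \<Rightarrow> real"
  assumes lip: "L-lipschitz_on S f" and "open S" "y \<in> S" and grad: "GDERIV f y :> v"
  shows "norm v \<le> L"
proof -
  define \<phi> where "\<phi> t = f (y + t *\<^sub>R v)" for t :: real
  have "(f has_derivative (\<lambda>w. w \<bullet> v)) (at (y + 0 *\<^sub>R v))"
    using grad by (simp add: gderiv_def)
  then have "(\<phi> has_derivative (\<lambda>t. (t *\<^sub>R v) \<bullet> v)) (at 0)"
    unfolding \<phi>_def
    by (intro has_derivative_compose[where g = f and f = "\<lambda>t. y + t *\<^sub>R v"])
      (auto intro!: derivative_eq_intros)
  then have "DERIV \<phi> 0 :> v \<bullet> v"
    unfolding has_field_derivative_def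
    by (rule has_derivative_eq_rhs) (simp add: fun_eq_iff mult.commute)
  then have lim: "((\<lambda>t. (\<phi> t - \<phi> 0) / t) \<longlongrightarrow> v \<bullet> v) (at 0)"
    using DERIV_D by fastforce
  have "((\<lambda>t. y + t *\<^sub>R v) \<longlongrightarrow> y + 0 *\<^sub>R v) (at 0)"
    by (intro tendsto_intros)
  then have "\<forall>\<^sub>F t in at 0. y + t *\<^sub>R v \<in> S"
    using topological_tendstoD \<open>open S\<close> \<open>y \<in> S\<close> by fastforce
  moreover have "\<forall>\<^sub>F t in at (0 :: real). t \<noteq> 0"
    by (simp add: eventually_at_filter)
  ultimately have "\<forall>\<^sub>F t in at 0. (\<phi> t - \<phi> 0) / t \<le> L * norm v"
  proof eventually_elim
    case (elim t)
    have "\<bar>\<phi> t - \<phi> 0\<bar> \<le> L * (\<bar>t\<bar> * norm v)"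
      using lipschitz_onD[OF lip elim(1) \<open>y \<in> S\<close>] by (simp add: \<phi>_def dist_norm)
    then have "\<bar>(\<phi> t - \<phi> 0) / t\<bar> \<le> L * norm v"
      using elim(2) by (simp add: abs_divide divide_le_eq mult_ac)
    then show ?case
      by linarith
  qed
  with lim have "v \<bullet> v \<le> L * norm v"
    by (rule tendsto_upperbound) simp
  then show ?thesis
    using lipschitz_on_nonneg[OF lip]
    by (cases "v = 0") (simp_all add: power2_norm_eq_inner[symmetric] power2_eq_square)
qed

text \<open>The distance to an empty set is $0$ by convention, so a Kurdyka-Lojasiewicz inequality requires
  Clarke subgradients to exist. Gradients near \<open>x\<close> are bounded by the Lipschitz constant and
  accumulate at one.\<close>

lemma clarke_subdifferential_nonempty:
  fixes f :: "'a::euclidean_space \<Rightarrow> real"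
  assumes lip: "locally_lipschitz f"
    and dense: "\<And>e. 0 < e \<Longrightarrow> \<exists>y. dist y x < e \<and> f differentiable (at y)"
  shows "clarke_subdifferential f x \<noteq> {}"
proof -
  obtain \<epsilon> L where "0 < \<epsilon>" and L: "L-lipschitz_on (ball x \<epsilon>) f"
    using lip unfolding locally_lipschitz_def by blast
  have "\<exists>y. dist y x < min \<epsilon> (inverse (real (Suc k))) \<and> f differentiable (at y)" for k
    using \<open>0 < \<epsilon>\<close> by (intro dense) simp
  then obtain y where y: "\<And>k. dist (y k) x < min \<epsilon> (inverse (real (Suc k)))"
    and diff: "\<And>k. f differentiable (at (y k))"
    by metis
  have "\<exists>v. GDERIV f (y k) :> v" for k
  proof -
    obtain f' where f': "(f has_derivative f') (at (y k))"
      using diff[of k] unfolding differentiable_def by blast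
    \<comment> \<open>the gradient is the Riesz representative of the derivative\<close>
    have "f' = (\<lambda>w. w \<bullet> adjoint f' 1)"
      using adjoint_works[OF has_derivative_linear[OF f'], of _ 1] by (simp add: fun_eq_iff)
    then show ?thesis
      using f' unfolding gderiv_def by metis
  qed
  then obtain v where v: "\<And>k. GDERIV f (y k) :> v k"
    by metis
  have "norm (v k) \<le> L" for k
    using y[of k] by (intro gradient_norm_le_lipschitz_constant[OF L _ _ v]) (simp_all add: dist_commute)
  then have "bounded (range v)"
    unfolding bounded_iff by blast
  then obtain l r where r: "strict_mono (r :: nat \<Rightarrow> nat)" and l: "(v \<circ> r) \<longlonglongrightarrow> l"
    using bounded_imp_convergent_subsequence by blast
  have "y \<longlonglongrightarrow> x"
    using y by (intro metric_tendsto_imp_tendsto[OF LIMSEQ_inverse_real_of_nat])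
      (simp add: less_imp_le del: of_nat_Suc)
  then have "(y \<circ> r) \<longlonglongrightarrow> x"
    using r by (rule LIMSEQ_subseq_LIMSEQ)
  then have "l \<in> clarke_subdifferential f x"
    unfolding clarke_subdifferential_def using l v
    by (intro hull_inc CollectI exI[of _ "y \<circ> r"] exI[of _ "v \<circ> r"]) simp
  then show ?thesis
    by blast
qed


section \<open>The entrywise absolute error\<close>

lemma norm_le_norm_l1: "norm A \<le> norm_l1 A"
proof -
  have "norm A \<le> (\<Sum>i\<in>UNIV. norm (A $ i))"
    unfolding norm_vec_def[of A] by (rule L2_set_le_sum) simp
  also have "\<dots> \<le> norm_l1 A"
    unfolding norm_l1_def by (intro sum_mono norm_le_l1_cart)
  finally show ?thesis .
qed

lemma norm_l1_le_norm:
  fixes A :: "real ^ 'n ^ 'm"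
  shows "norm_l1 A \<le> real (CARD('m) * CARD('n)) * norm A"
proof -
  have "\<bar>A $ i $ j\<bar> \<le> norm A" for i j
    using component_le_norm_cart[where x = "A $ i" and i = j] Finite_Cartesian_Product.norm_nth_le[where x = A and i = i] by linarith
  then have "norm_l1 A \<le> (\<Sum>i\<in>(UNIV :: 'm set). \<Sum>j\<in>(UNIV :: 'n set). norm A)"
    unfolding norm_l1_def by (intro sum_mono)
  then show ?thesis
    by simp
qed

lemma norm_l1_triangle: "norm_l1 (A + B) \<le> norm_l1 A + norm_l1 B"
  unfolding norm_l1_def sum.distrib[symmetric] by (intro sum_mono) simp

lemma norm_l1_scaleR: "norm_l1 (c *\<^sub>R A) = \<bar>c\<bar> * norm_l1 A"
  unfolding norm_l1_def by (simp add: abs_mult sum_distrib_left)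

lemma convex_norm_l1_diff:
  fixes M :: "real ^ 'n ^ 'm"
  shows "convex_on UNIV (\<lambda>Z. norm_l1 (Z - M))"
proof (rule convex_onI)
  fix t and A B :: "real ^ 'n ^ 'm"
  assume t: "0 < t" "t < (1 :: real)"
  have "(1 - t) *\<^sub>R A + t *\<^sub>R B - M = (1 - t) *\<^sub>R (A - M) + t *\<^sub>R (B - M)"
    by (simp add: algebra_simps)
  then show "norm_l1 ((1 - t) *\<^sub>R A + t *\<^sub>R B - M) \<le> (1 - t) * norm_l1 (A - M) + t * norm_l1 (B - M)"
    using norm_l1_triangle[of "(1 - t) *\<^sub>R (A - M)" "t *\<^sub>R (B - M)"] t by (simp add: norm_l1_scaleR)
qed simp

lemma norm_l1_diff_lipschitz:
  fixes M :: "real ^ 'n ^ 'm"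
  shows "(real (CARD('m) * CARD('n)))-lipschitz_on S (\<lambda>Z. norm_l1 (Z - M))"
proof (rule lipschitz_onI)
  fix A B :: "real ^ 'n ^ 'm"
  have "norm_l1 (A - M) \<le> norm_l1 (A - B) + norm_l1 (B - M)"
    "norm_l1 (B - M) \<le> norm_l1 (B - A) + norm_l1 (A - M)"
    using norm_l1_triangle[of "A - B" "B - M"] norm_l1_triangle[of "B - A" "A - M"] by simp_all
  moreover have "norm_l1 (B - A) = norm_l1 (A - B)"
    using norm_l1_scaleR[of "-1" "A - B"] by simp
  ultimately show "dist (norm_l1 (A - M)) (norm_l1 (B - M)) \<le> real (CARD('m) * CARD('n)) * dist A B"
    using norm_l1_le_norm[of "A - B"] unfolding dist_norm[of A B] dist_real_def by linarith
qed simp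

lemma f_1_differentiable:
  assumes nz: "\<And>i j. (fst z ** snd z - M) $ i $ j \<noteq> 0"
  shows "f_1 M differentiable (at z)"
proof -
  have entry: "(\<lambda>z. \<bar>(fst z ** snd z - M) $ i $ j\<bar>) differentiable (at z)" for i j
  proof -
    let ?e = "\<lambda>z. (fst z ** snd z - M) $ i $ j"
    have "(?e has_derivative (\<lambda>w. (fst z ** snd w + fst w ** snd z - 0) $ i $ j)) (at z)"
      by (intro bounded_linear.has_derivative[OF bounded_linear_vec_nth] has_derivative_diff
        has_derivative_matrix_product has_derivative_const)
    then have "?e differentiable (at z)"
      unfolding differentiable_def by blast
    then have "(norm \<circ> ?e) differentiable (at z)"
      using nz by (intro differentiable_chain_at differentiable_norm_at) auto
    then show ?thesis
      by (simp add: o_def)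
  qed
  have "(\<lambda>z. \<Sum>i\<in>UNIV. \<Sum>j\<in>UNIV. \<bar>(fst z ** snd z - M) $ i $ j\<bar>) differentiable (at z)"
    by (intro differentiable_sum entry ballI) simp_all
  then show ?thesis
    by (simp add: f_1_def norm_l1_def case_prod_unfold)
qed

text \<open>On the line through \<open>z\<close> whose direction has all entries $1$, each entry of \<open>X ** Y - M\<close> is a quadratic
  polynomial with leading coefficient $r$, so that only finitely many points of the line have to be
  avoided.\<close>

lemma f_1_differentiable_dense:
  fixes z :: "(real ^ 'r ^ 'm) \<times> (real ^ 'n ^ 'r)" and M :: "real ^ 'n ^ 'm"
  assumes "0 < e"
  shows "\<exists>y. dist y z < e \<and> f_1 M differentiable (at y)"
proof -
  define u where "u = ((\<chi> i j. 1, \<chi> i j. 1) :: (real ^ 'r ^ 'm) \<times> (real ^ 'n ^ 'r))"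
  define p where "p i j = [:(fst z ** snd z - M) $ i $ j, (fst z ** snd u + fst u ** snd z) $ i $ j,
    (fst u ** snd u) $ i $ j:]" for i j
  have p: "(fst (z + t *\<^sub>R u) ** snd (z + t *\<^sub>R u) - M) $ i $ j = poly (p i j) t" for t i j
    by (simp add: p_def matrix_mult_ring_simps matrix_mult_scaleR algebra_simps)
  have "(fst u ** snd u) $ i $ j \<noteq> 0" for i j
    by (simp add: u_def matrix_matrix_mult_def)
  then have "p i j \<noteq> 0" for i j
    by (simp add: p_def)
  then have "finite (\<Union>i. \<Union>j. {t. poly (p i j) t = 0})"
    by (intro finite_UN_I poly_roots_finite) simp_all
  moreover have "infinite {0<..<e / norm u}"
    using \<open>0 < e\<close> by (intro infinite_Ioo) (simp add: u_def zero_prod_def vec_eq_iff)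
  ultimately have "infinite ({0<..<e / norm u} - (\<Union>i. \<Union>j. {t. poly (p i j) t = 0}))"
    by (rule Diff_infinite_finite)
  then have "{0<..<e / norm u} - (\<Union>i. \<Union>j. {t. poly (p i j) t = 0}) \<noteq> {}"
    by (rule infinite_imp_nonempty)
  then obtain t where "t \<in> {0<..<e / norm u} - (\<Union>i. \<Union>j. {t. poly (p i j) t = 0})"
    by blast
  then have t: "0 < t" "t < e / norm u" and roots: "poly (p i j) t \<noteq> 0" for i j
    by simp_all
  have "u \<noteq> 0"
    by (simp add: u_def zero_prod_def vec_eq_iff)
  then have "dist (z + t *\<^sub>R u) z < e"
    using t by (simp add: dist_norm pos_less_divide_eq)
  moreover have "f_1 M differentiable (at (z + t *\<^sub>R u))"
    by (rule f_1_differentiable) (simp only: p roots not_False_eq_True)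
  ultimately show ?thesis
    by blast
qed

lemma f_1_locally_lipschitz:
  "locally_lipschitz (f_1 M :: (real ^ 'r ^ 'm) \<times> (real ^ 'n ^ 'r) \<Rightarrow> real)"
  unfolding f_1_def using norm_l1_diff_lipschitz by (intro locally_lipschitz_product) blast

text \<open>The exponent \<open>\<kappa>\<close> is $1$: all norms on matrices are equivalent.\<close>

theorem f_1_has_KL_exponent:
  fixes X0 :: "real ^ 'r ^ 'm" and Y0 :: "real ^ 'n ^ 'r"
  assumes "0 < \<theta>" "\<theta> \<le> 1" and solvable: "product_error_linearizable \<theta> X0 Y0"
  shows "has_KL_exponent (f_1 (X0 ** Y0)) (1 - \<theta>) (X0, Y0)"
proof -
  define h where "h Z = norm_l1 (Z - X0 ** Y0)" for Z :: "real ^ 'n ^ 'm"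
  have f: "(\<lambda>(X :: real ^ 'r ^ 'm, Y). h (X ** Y)) = f_1 (X0 ** Y0)"
    by (simp add: f_1_def h_def)
  have h0: "h (X0 ** Y0) = 0"
    by (simp add: h_def norm_l1_def)
  have "has_KL_exponent (\<lambda>(X, Y). h (X ** Y)) (1 - \<theta> / 1) (X0, Y0)"
  proof (rule has_KL_exponent_product[where \<mu> = 1 and L = "real (CARD('m) * CARD('n))"])
    show "convex_on UNIV h"
      unfolding h_def[abs_def] by (rule convex_norm_l1_diff)
    show "continuous_on UNIV h"
      unfolding h_def[abs_def] using norm_l1_diff_lipschitz by (rule lipschitz_on_continuous_on)
    show "locally_lipschitz (\<lambda>(X :: real ^ 'r ^ 'm, Y). h (X ** Y))"
      unfolding f by (rule f_1_locally_lipschitz)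
    show "clarke_subdifferential (\<lambda>(X :: real ^ 'r ^ 'm, Y). h (X ** Y)) z \<noteq> {}" for z
      unfolding f by (intro clarke_subdifferential_nonempty f_1_locally_lipschitz f_1_differentiable_dense)
    show "1 * norm (X ** Y - X0 ** Y0) powr 1 \<le> h (X ** Y) - h (X0 ** Y0)" for X :: "real ^ 'r ^ 'm" and Y
      using norm_le_norm_l1[of "X ** Y - X0 ** Y0"] unfolding h0 by (simp add: h_def)
    show "h (X0 ** Y0 + E) - h (X0 ** Y0) \<le> real (CARD('m) * CARD('n)) * norm E powr 1" for E
      using norm_l1_le_norm[of E] unfolding h0 by (simp add: h_def)
  qed (use assms in simp_all)
  then show ?thesis
    unfolding f by simp
qed


section \<open>Matrix sensing\<close>

lemma rank_diff_le:
  fixes A B :: "real ^ 'n ^ 'm"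
  shows "rank (A - B) \<le> rank A + rank B"
proof -
  let ?R = "\<lambda>C :: real ^ 'n ^ 'm. range ((*v) C)"
  have sub: "subspace (?R C)" for C
    by (intro linear_subspace_image subspace_UNIV) simp
  have "?R (A - B) \<subseteq> {x + y |x y. x \<in> ?R A \<and> y \<in> ?R B}"
  proof clarify
    fix v
    have "(A - B) *v v = A *v v + B *v (- v)"
      using linear_neg[OF matrix_vector_mul_linear, of B v] by (simp add: matrix_vector_mult_diff_rdistrib)
    then show "\<exists>x y. (A - B) *v v = x + y \<and> x \<in> ?R A \<and> y \<in> ?R B"
      by blast
  qed
  then have "dim (?R (A - B)) \<le> dim {x + y |x y. x \<in> ?R A \<and> y \<in> ?R B}"
    by (rule dim_subset)
  also have "\<dots> \<le> dim (?R A) + dim (?R B)"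
    using dim_sums_Int[OF sub sub, of A B] by linarith
  finally show ?thesis
    by (simp add: rank_dim_range)
qed

text \<open>The functions in the restricted isometry condition are only known to be derivatives of \<open>g_ms\<close>, so
  they are identified by uniqueness of derivatives.\<close>

lemma g_ms_second_derivative:
  fixes \<A> :: "real ^ 'n ^ 'm \<Rightarrow> real ^ 'N"
  assumes lin: "linear \<A>" and C2: "C2_with_derivatives (g_ms \<A> b) g' g''"
  shows "blinfun_apply (blinfun_apply (g'' A) H) H = 2 * (norm (\<A> H))\<^sup>2"
proof -
  have bl: "bounded_linear \<A>"
    using lin by (simp add: linear_conv_bounded_linear)
  have D\<A>: "((\<lambda>B. \<A> B - b) has_derivative \<A>) (at B)" for B
    using has_derivative_diff[OF bounded_linear.has_derivative[OF bl has_derivative_ident] has_derivative_const]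
    by simp
  have "(g_ms \<A> b has_derivative (\<lambda>K. 2 * (\<A> K \<bullet> (\<A> B - b)))) (at B)" for B
  proof -
    have "((\<lambda>B. (\<A> B - b) \<bullet> (\<A> B - b)) has_derivative (\<lambda>K. (\<A> B - b) \<bullet> \<A> K + \<A> K \<bullet> (\<A> B - b))) (at B)"
      by (intro has_derivative_inner D\<A>)
    moreover have "g_ms \<A> b = (\<lambda>B. (\<A> B - b) \<bullet> (\<A> B - b))"
      by (simp add: g_ms_def[abs_def] power2_norm_eq_inner)
    moreover have "(\<lambda>K. (\<A> B - b) \<bullet> \<A> K + \<A> K \<bullet> (\<A> B - b)) = (\<lambda>K. 2 * (\<A> K \<bullet> (\<A> B - b)))"
      by (simp add: inner_commute)
    ultimately show ?thesis
      by simp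
  qed
  note g_ms_derivative = this
  have g': "blinfun_apply (g' B) H = 2 * (\<A> H \<bullet> (\<A> B - b))" for B
  proof -
    have "(g_ms \<A> b has_derivative blinfun_apply (g' B)) (at B)"
      using C2 unfolding C2_with_derivatives_def by blast
    from has_derivative_unique[OF this g_ms_derivative]
    show ?thesis
      by simp
  qed
  have "((\<lambda>B. 2 * (\<A> H \<bullet> (\<A> B - b))) has_derivative (\<lambda>K. 2 * (\<A> H \<bullet> \<A> K))) (at A)"
    by (intro has_derivative_mult_right has_derivative_inner_right D\<A>)
  moreover have "((\<lambda>B. blinfun_apply (g' B) H) has_derivative (\<lambda>K. blinfun_apply (blinfun_apply (g'' A) K) H)) (at A)"
    using C2 unfolding C2_with_derivatives_def
    by (intro bounded_linear.has_derivative[OF blinfun.bounded_linear_left]) blast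
  ultimately have "(\<lambda>K. blinfun_apply (blinfun_apply (g'' A) K) H) = (\<lambda>K. 2 * (\<A> H \<bullet> \<A> K))"
    unfolding g' by (intro has_derivative_unique)
  then show ?thesis
    by (simp add: fun_eq_iff power2_norm_eq_inner)
qed

text \<open>Since the second derivative is constant, the condition is used at the point $0$, whose rank meets
  every bound.\<close>

lemma RIP_g_ms_lower_bound:
  fixes \<A> :: "real ^ 'n ^ 'm \<Rightarrow> real ^ 'N"
  assumes "linear \<A>" and RIP: "RIP \<delta> w t (g_ms \<A> b)" and rank: "rank E \<le> t"
  shows "(1 - \<delta>) / 2 * (norm E)\<^sup>2 \<le> (norm (\<A> E))\<^sup>2"
proof -
  obtain g' g'' where C2: "C2_with_derivatives (g_ms \<A> b) g' g''"
    and lower: "\<And>A H. rank A \<le> w \<Longrightarrow> rank H \<le> t \<Longrightarrow> (1 - \<delta>) * (norm H)\<^sup>2 \<le> blinfun_apply (blinfun_apply (g'' A) H) H"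
    using RIP unfolding RIP_def by blast
  show ?thesis
    using lower[of 0 E] rank g_ms_second_derivative[OF \<open>linear \<A>\<close> C2, of 0 E] by simp
qed

text \<open>At a minimizer the linear term of the quadratic function vanishes.\<close>

lemma g_ms_minimizer_expansion:
  fixes \<A> :: "real ^ 'n ^ 'm \<Rightarrow> real ^ 'N"
  assumes lin: "linear \<A>" and min: "\<forall>A. g_ms \<A> b M \<le> g_ms \<A> b A"
  shows "g_ms \<A> b (M + E) - g_ms \<A> b M = (norm (\<A> E))\<^sup>2"
proof -
  have expand: "g_ms \<A> b (M + t *\<^sub>R E) - g_ms \<A> b M = 2 * t * (\<A> E \<bullet> (\<A> M - b)) + t\<^sup>2 * (norm (\<A> E))\<^sup>2" for t
  proof -
    have "\<A> (M + t *\<^sub>R E) - b = (\<A> M - b) + t *\<^sub>R \<A> E"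
      by (simp add: linear_add[OF lin] linear_cmul[OF lin])
    then show ?thesis
      unfolding g_ms_def power2_norm_eq_inner
      by (simp add: inner_add_left inner_add_right inner_commute power2_eq_square algebra_simps)
  qed
  define c where "c = \<A> E \<bullet> (\<A> M - b)"
  define k where "k = (norm (\<A> E))\<^sup>2 + 1"
  have "0 < k"
    unfolding k_def by (simp add: add_nonneg_pos)
  \<comment> \<open>if \<open>c\<close> were not zero, the step \<open>- c / k\<close> along \<open>E\<close> would decrease the value\<close>
  have "0 \<le> 2 * (- c / k) * c + (- c / k)\<^sup>2 * (norm (\<A> E))\<^sup>2"
    using spec[OF min, of "M + (- c / k) *\<^sub>R E"] expand[of "- c / k"] unfolding c_def[symmetric] by linarith
  also have "\<dots> \<le> 2 * (- c / k) * c + (- c / k)\<^sup>2 * k"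
    by (intro add_left_mono mult_left_mono) (simp_all add: k_def)
  also have "\<dots> = - (c\<^sup>2 / k)"
    using \<open>0 < k\<close> by (simp add: power2_eq_square field_simps)
  finally have "c\<^sup>2 / k \<le> 0"
    by simp
  then have "c = 0"
    using \<open>0 < k\<close> by (simp add: divide_le_0_iff)
  then show ?thesis
    using expand[of 1] by (simp add: c_def)
qed

lemma convex_g_ms:
  fixes \<A> :: "real ^ 'n ^ 'm \<Rightarrow> real ^ 'N"
  assumes lin: "linear \<A>"
  shows "convex_on UNIV (g_ms \<A> b)"
proof (rule convex_onI)
  fix t and A B :: "real ^ 'n ^ 'm"
  assume t: "0 < t" "t < (1 :: real)"
  have "\<A> ((1 - t) *\<^sub>R A + t *\<^sub>R B) - b = (1 - t) *\<^sub>R (\<A> A - b) + t *\<^sub>R (\<A> B - b)"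
    by (simp add: linear_add[OF lin] linear_diff[OF lin] linear_cmul[OF lin] algebra_simps)
  then have "g_ms \<A> b ((1 - t) *\<^sub>R A + t *\<^sub>R B) = (norm ((1 - t) *\<^sub>R (\<A> A - b) + t *\<^sub>R (\<A> B - b)))\<^sup>2"
    by (simp add: g_ms_def)
  also have "\<dots> = (1 - t) * (norm (\<A> A - b))\<^sup>2 + t * (norm (\<A> B - b))\<^sup>2
      - t * (1 - t) * (norm ((\<A> A - b) - (\<A> B - b)))\<^sup>2"
    unfolding power2_norm_eq_inner
    by (simp add: inner_add_left inner_add_right inner_diff_left inner_diff_right inner_commute algebra_simps)
  also have "\<dots> \<le> (1 - t) * (norm (\<A> A - b))\<^sup>2 + t * (norm (\<A> B - b))\<^sup>2"
    using t by simp
  finally show "g_ms \<A> b ((1 - t) *\<^sub>R A + t *\<^sub>R B) \<le> (1 - t) * g_ms \<A> b A + t * g_ms \<A> b B"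
    by (simp add: g_ms_def)
qed simp

lemma g_ms_lipschitz_on_cball:
  fixes \<A> :: "real ^ 'n ^ 'm \<Rightarrow> real ^ 'N"
  assumes lin: "linear \<A>" and "0 \<le> R"
  shows "\<exists>L. L-lipschitz_on (cball 0 R) (g_ms \<A> b)"
proof -
  obtain c where "0 < c" and c: "\<And>Z. norm (\<A> Z) \<le> c * norm Z"
    using linear_bounded_pos[OF lin] by blast
  define K where "K = 2 * (c * R + norm b)"
  have "0 \<le> K"
    using \<open>0 < c\<close> \<open>0 \<le> R\<close> by (simp add: K_def)
  have "(K * c)-lipschitz_on (cball 0 R) (g_ms \<A> b)"
  proof (rule lipschitz_onI)
    fix A B :: "real ^ 'n ^ 'm"
    assume "A \<in> cball 0 R" "B \<in> cball 0 R"
    then have "norm (\<A> A) \<le> c * R" "norm (\<A> B) \<le> c * R"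
      using c[of A] c[of B] \<open>0 < c\<close> by (simp_all add: order_trans[OF _ mult_left_mono])
    then have sum_le: "norm ((\<A> A - b) + (\<A> B - b)) \<le> K"
      using norm_triangle_ineq[of "\<A> A - b" "\<A> B - b"] norm_triangle_ineq4[of "\<A> A" b]
        norm_triangle_ineq4[of "\<A> B" b] by (simp add: K_def)
    have "g_ms \<A> b A - g_ms \<A> b B = ((\<A> A - b) + (\<A> B - b)) \<bullet> ((\<A> A - b) - (\<A> B - b))"
    proof -
      have "x \<bullet> x - y \<bullet> y = (x + y) \<bullet> (x - y)" for x y :: "real ^ 'N"
        by (simp add: inner_add_left inner_add_right inner_diff_left inner_diff_right inner_commute)
      then show ?thesis
        by (simp only: g_ms_def power2_norm_eq_inner)
    qed
    then have "dist (g_ms \<A> b A) (g_ms \<A> b B) \<le> norm ((\<A> A - b) + (\<A> B - b)) * norm (\<A> A - \<A> B)"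
      using Cauchy_Schwarz_ineq2[of "(\<A> A - b) + (\<A> B - b)" "(\<A> A - b) - (\<A> B - b)"]
      by (simp add: dist_real_def)
    also have "\<dots> \<le> K * (c * dist A B)"
      using sum_le c[of "A - B"] \<open>0 \<le> K\<close> by (intro mult_mono) (simp_all add: linear_diff[OF lin] dist_norm)
    finally show "dist (g_ms \<A> b A) (g_ms \<A> b B) \<le> K * c * dist A B"
      by (simp add: mult.assoc)
  qed (use \<open>0 \<le> K\<close> \<open>0 < c\<close> in simp)
  then show ?thesis
    by blast
qed

lemma f_ms_locally_lipschitz:
  assumes "linear \<A>"
  shows "locally_lipschitz (f_ms \<A> b :: (real ^ 'r ^ 'm) \<times> (real ^ 'n ^ 'r) \<Rightarrow> real)"
  unfolding f_ms_def using assms by (intro locally_lipschitz_product g_ms_lipschitz_on_cball)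

lemma f_ms_differentiable:
  assumes "linear \<A>"
  shows "(f_ms \<A> b :: (real ^ 'r ^ 'm) \<times> (real ^ 'n ^ 'r) \<Rightarrow> real) differentiable (at z)"
proof -
  have "bounded_linear \<A>"
    using assms by (simp add: linear_conv_bounded_linear)
  then have "((\<lambda>z :: (real ^ 'r ^ 'm) \<times> (real ^ 'n ^ 'r). \<A> (fst z ** snd z) - b) has_derivative
      (\<lambda>w. \<A> (fst z ** snd w + fst w ** snd z) - 0)) (at z)"
    by (intro has_derivative_diff bounded_linear.has_derivative[of \<A>] has_derivative_matrix_product has_derivative_const)
  from has_derivative_inner[OF this this] show ?thesis
    unfolding differentiable_def f_ms_def g_ms_def power2_norm_eq_inner case_prod_unfold by blast
qed

text \<open>The error has rank at most \<open>rank (X0 ** Y0) + r\<close>, which is why the restricted isometry condition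
  provides the quadratic growth \<open>\<kappa> = 2\<close> along products \<open>X ** Y\<close>, although \<open>g_ms\<close> need not grow
  quadratically on all matrices.\<close>

theorem f_ms_has_KL_exponent:
  fixes X0 :: "real ^ 'r ^ 'm" and Y0 :: "real ^ 'n ^ 'r"
    and \<A> :: "real ^ 'n ^ 'm \<Rightarrow> real ^ 'N"
  assumes lin: "linear \<A>" and "\<delta> < 1"
    and RIP: "RIP \<delta> w (rank (X0 ** Y0) + CARD('r)) (g_ms \<A> b)"
    and min: "\<forall>A. g_ms \<A> b (X0 ** Y0) \<le> g_ms \<A> b A"
    and "0 < \<theta>" "\<theta> \<le> 2" and solvable: "product_error_linearizable \<theta> X0 Y0"
  shows "has_KL_exponent (f_ms \<A> b) (1 - \<theta> / 2) (X0, Y0)"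
proof -
  obtain c where "0 < c" and c: "\<And>Z. norm (\<A> Z) \<le> c * norm Z"
    using linear_bounded_pos[OF lin] by blast
  note expansion = g_ms_minimizer_expansion[OF lin min]
  have powr_2: "norm E powr 2 = (norm E)\<^sup>2" for E :: "real ^ 'n ^ 'm"
    by (cases "E = 0") (simp_all add: powr_numeral)
  have "has_KL_exponent (\<lambda>(X, Y). g_ms \<A> b (X ** Y)) (1 - \<theta> / 2) (X0, Y0)"
  proof (rule has_KL_exponent_product[where \<mu> = "(1 - \<delta>) / 2" and L = "c\<^sup>2"])
    show "convex_on UNIV (g_ms \<A> b)"
      using lin by (rule convex_g_ms)
    show "continuous_on UNIV (g_ms \<A> b)"
      unfolding g_ms_def[abs_def] using lin by (intro continuous_intros linear_continuous_on)
        (simp add: linear_conv_bounded_linear)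
    show "locally_lipschitz (\<lambda>(X :: real ^ 'r ^ 'm, Y). g_ms \<A> b (X ** Y))"
      using f_ms_locally_lipschitz[OF lin] unfolding f_ms_def .
    show "clarke_subdifferential (\<lambda>(X :: real ^ 'r ^ 'm, Y). g_ms \<A> b (X ** Y)) z \<noteq> {}" for z
      unfolding f_ms_def[symmetric]
      by (intro clarke_subdifferential_nonempty f_ms_locally_lipschitz lin exI[of _ z] conjI
        f_ms_differentiable[OF lin]) simp
    show "(1 - \<delta>) / 2 * norm (X ** Y - X0 ** Y0) powr 2 \<le> g_ms \<A> b (X ** Y) - g_ms \<A> b (X0 ** Y0)"
      for X :: "real ^ 'r ^ 'm" and Y
    proof -
      have "rank (X ** Y - X0 ** Y0) \<le> rank (X ** Y) + rank (X0 ** Y0)"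
        by (rule rank_diff_le)
      also have "rank (X ** Y) \<le> CARD('r)"
        using rank_mul_le_left[of X Y] rank_bound[of X] by simp
      finally have "(1 - \<delta>) / 2 * (norm (X ** Y - X0 ** Y0))\<^sup>2 \<le> (norm (\<A> (X ** Y - X0 ** Y0)))\<^sup>2"
        by (intro RIP_g_ms_lower_bound[OF lin RIP]) simp
      then show ?thesis
        using expansion[of "X ** Y - X0 ** Y0"] by (simp add: powr_2)
    qed
    show "g_ms \<A> b (X0 ** Y0 + E) - g_ms \<A> b (X0 ** Y0) \<le> c\<^sup>2 * norm E powr 2" for E
      unfolding expansion powr_2 power_mult_distrib[symmetric] using c by (intro power_mono) simp_all
  qed (use assms \<open>0 < c\<close> in simp_all)
  then show ?thesis
    unfolding f_ms_def .
qed


section \<open>Generalized inverses of the factors in O(p,q)\<close>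

lemma bij_betw_pos: "bij_betw pos (UNIV :: 'k::finite set) {..<CARD('k)}"
  unfolding pos_def by (rule to_nat_on_finite) simp

lemma pos_less_card: "pos (i :: 'k::finite) < CARD('k)"
  using bij_betw_pos bij_betwE by blast

lemma pos_eq_iff: "pos i = pos j \<longleftrightarrow> i = j"
  using bij_betw_pos by (auto dest: bij_betw_imp_inj_on inj_onD)

lemma sum_pos: "(\<Sum>k\<in>(UNIV :: 'k::finite set). g (pos k)) = (\<Sum>t<CARD('k). g t)"
  by (rule sum.reindex_bij_betw[OF bij_betw_pos])

definition coordinate_projection :: "(nat \<Rightarrow> bool) \<Rightarrow> real ^ 'k ^ 'k" where
  "coordinate_projection P = (\<chi> i j. if i = j \<and> P (pos i) then 1 else 0)"

lemma coordinate_projection_mult_left: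
  assumes "\<And>i j. \<not> P (pos i) \<Longrightarrow> A $ i $ j = 0"
  shows "coordinate_projection P ** A = A"
proof -
  have "(coordinate_projection P ** A) $ i $ j = A $ i $ j" for i j
  proof -
    have "(coordinate_projection P ** A) $ i $ j = (\<Sum>k\<in>UNIV. if k = i then (if P (pos i) then A $ i $ j else 0) else 0)"
      unfolding matrix_matrix_mult_def coordinate_projection_def vec_lambda_beta
      by (intro sum.cong) auto
    then show ?thesis
      using assms by simp
  qed
  then show ?thesis
    by (simp add: vec_eq_iff)
qed

lemma coordinate_projection_mult:
  "coordinate_projection P ** coordinate_projection Q = (coordinate_projection (\<lambda>i. P i \<and> Q i) :: real ^ 'k ^ 'k)"
proof -
  have "(coordinate_projection P ** coordinate_projection Q :: real ^ 'k ^ 'k) $ i $ j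
      = (\<Sum>k\<in>UNIV. if k = i then (if i = j \<and> P (pos i) \<and> Q (pos i) then 1 else 0) else 0)" for i j
    unfolding matrix_matrix_mult_def coordinate_projection_def vec_lambda_beta
      by (intro sum.cong) auto
  then show ?thesis
    by (simp add: vec_eq_iff coordinate_projection_def)
qed

lemma coordinate_projection_eq_mat_1:
  assumes "\<And>i. i < CARD('k) \<Longrightarrow> P i"
  shows "coordinate_projection P = (mat 1 :: real ^ 'k ^ 'k)"
  using assms by (simp add: vec_eq_iff coordinate_projection_def mat_def pos_less_card)

lemma coordinate_projection_eq_0:
  assumes "\<And>i. i < CARD('k) \<Longrightarrow> \<not> P i"
  shows "coordinate_projection P = (0 :: real ^ 'k ^ 'k)"
  using assms by (simp add: vec_eq_iff coordinate_projection_def pos_less_card)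

lemma mat_1_minus_coordinate_projection:
  "mat 1 - coordinate_projection P = (coordinate_projection (\<lambda>i. \<not> P i) :: real ^ 'k ^ 'k)"
  by (simp add: vec_eq_iff coordinate_projection_def mat_def)

lemma left_block_mult:
  assumes "s + p \<le> CARD('r)"
  shows "(left_block s p :: real ^ 'r ^ 'm) ** (left_block s p :: real ^ 'm ^ 'r)
    = coordinate_projection (\<lambda>i. i < s + p)"
proof -
  have "((left_block s p :: real ^ 'r ^ 'm) ** (left_block s p :: real ^ 'm ^ 'r)) $ i $ j
      = (\<Sum>t<CARD('r). if t = pos i then (if i = j \<and> pos i < s + p then 1 else 0) else 0)"
    (is "_ = (\<Sum>t<_. ?g t)") for i j
  proof -
    have "((left_block s p :: real ^ 'r ^ 'm) ** (left_block s p :: real ^ 'm ^ 'r)) $ i $ j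
        = (\<Sum>k\<in>UNIV. ?g (pos (k :: 'r)))"
      unfolding matrix_matrix_mult_def left_block_def vec_lambda_beta
      by (intro sum.cong) (auto simp: pos_eq_iff)
    also have "\<dots> = (\<Sum>t<CARD('r). ?g t)"
      by (rule sum_pos[where g = ?g])
    finally show ?thesis .
  qed
  then show ?thesis
    using assms by (auto simp: vec_eq_iff coordinate_projection_def)
qed

definition right_block_inverse :: "nat \<Rightarrow> (nat \<Rightarrow> real) \<Rightarrow> nat \<Rightarrow> nat \<Rightarrow> real ^ 'r ^ 'n" where
  "right_block_inverse s d p q = transpose (right_block s (\<lambda>k. 1 / d k) p q)"

text \<open>Each row and each column of \<open>right_block\<close> has at most one nonzero entry. The next three definitions
  locate it, which reduces sums over such products to a single term.\<close>

definition row_column :: "nat \<Rightarrow> nat \<Rightarrow> nat \<Rightarrow> nat" where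
  "row_column s p a = (if a < s then a else a - p)"

definition column_row :: "nat \<Rightarrow> nat \<Rightarrow> nat \<Rightarrow> nat" where
  "column_row s p b = (if b < s then b else b + p)"

definition nonzero_row :: "nat \<Rightarrow> nat \<Rightarrow> nat \<Rightarrow> nat \<Rightarrow> bool" where
  "nonzero_row s p q a \<longleftrightarrow> a < s \<or> s + p \<le> a \<and> a < s + p + q"

lemma right_block_row:
  "right_block s d p q $ i $ j =
    (if nonzero_row s p q (pos i) \<and> pos j = row_column s p (pos i)
     then (if pos i < s then d (pos i) else 1) else 0)"
proof -
  have "(\<exists>k<q. pos i = s + p + k \<and> pos j = s + k) \<longleftrightarrow> s + p \<le> pos i \<and> pos i < s + p + q \<and> pos j = pos i - p"
    by (auto intro!: exI[of _ "pos j - s"])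
  then show ?thesis
    unfolding right_block_def row_column_def nonzero_row_def vec_lambda_beta by (cases "pos i < s") auto
qed

lemma right_block_column:
  "right_block s d p q $ i $ j =
    (if pos j < s + q \<and> pos i = column_row s p (pos j)
     then (if pos j < s then d (pos j) else 1) else 0)"
proof -
  have "(\<exists>k<q. pos i = s + p + k \<and> pos j = s + k) \<longleftrightarrow> s \<le> pos j \<and> pos j < s + q \<and> pos i = pos j + p"
    by (auto intro!: exI[of _ "pos j - s"])
  then show ?thesis
    unfolding right_block_def column_row_def vec_lambda_beta by (cases "pos j < s") auto
qed

lemma row_column_inject:
  assumes "nonzero_row s p q a" "nonzero_row s p q a'" "row_column s p a = row_column s p a'"
  shows "a = a'"
  using assms unfolding row_column_def nonzero_row_def by (auto split: if_splits)

lemma column_row_inject: "column_row s p b = column_row s p b' \<Longrightarrow> b = b'"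
  unfolding column_row_def by (auto split: if_splits)

lemma right_block_mult_inverse:
  assumes n: "s + q \<le> CARD('n)" and d: "\<forall>k<s. 0 < d k"
  shows "(right_block s d p q :: real ^ 'n ^ 'r) ** right_block_inverse s d p q
    = coordinate_projection (nonzero_row s p q)"
proof -
  have "((right_block s d p q :: real ^ 'n ^ 'r) ** right_block_inverse s d p q) $ i $ j
      = (\<Sum>t<CARD('n). if t = row_column s p (pos i) then
          (if i = j \<and> nonzero_row s p q (pos i) then 1 else 0) else 0)"
    (is "_ = (\<Sum>t<_. ?g t)") for i j
  proof -
    have summand: "right_block s d p q $ i $ k * right_block s (\<lambda>k. 1 / d k) p q $ j $ k = ?g (pos k)" for k :: 'n
      using d row_column_inject[of s p q "pos i" "pos j"]
      unfolding right_block_row by (cases "i = j") (auto simp: pos_eq_iff)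
    have "((right_block s d p q :: real ^ 'n ^ 'r) ** right_block_inverse s d p q) $ i $ j
        = (\<Sum>k\<in>UNIV. ?g (pos (k :: 'n)))"
      unfolding matrix_matrix_mult_def right_block_inverse_def transpose_def vec_lambda_beta summand ..
    also have "\<dots> = (\<Sum>t<CARD('n). ?g t)"
      by (rule sum_pos[where g = ?g])
    finally show ?thesis .
  qed
  moreover have "row_column s p (pos (i :: 'r)) < CARD('n)" if "nonzero_row s p q (pos i)" for i
    using that n unfolding row_column_def nonzero_row_def by auto
  ultimately show ?thesis
    by (simp add: vec_eq_iff coordinate_projection_def)
qed

lemma right_block_inverse_mult:
  assumes r: "s + p + q \<le> CARD('r)" and d: "\<forall>k<s. 0 < d k"
  shows "right_block_inverse s d p q ** (right_block s d p q :: real ^ 'n ^ 'r)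
    = coordinate_projection (\<lambda>i. i < s + q)"
proof -
  have "(right_block_inverse s d p q ** (right_block s d p q :: real ^ 'n ^ 'r)) $ i $ j
      = (\<Sum>t<CARD('r). if t = column_row s p (pos i) then
          (if i = j \<and> pos i < s + q then 1 else 0) else 0)"
    (is "_ = (\<Sum>t<_. ?g t)") for i j
  proof -
    have summand: "right_block s (\<lambda>k. 1 / d k) p q $ k $ i * right_block s d p q $ k $ j = ?g (pos k)" for k :: 'r
      using d column_row_inject[of s p "pos i" "pos j"]
      unfolding right_block_column by (cases "i = j") (auto simp: pos_eq_iff)
    have "(right_block_inverse s d p q ** (right_block s d p q :: real ^ 'n ^ 'r)) $ i $ j
        = (\<Sum>k\<in>UNIV. ?g (pos (k :: 'r)))"
      unfolding matrix_matrix_mult_def right_block_inverse_def transpose_def vec_lambda_beta summand ..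
    also have "\<dots> = (\<Sum>t<CARD('r). ?g t)"
      by (rule sum_pos[where g = ?g])
    finally show ?thesis .
  qed
  moreover have "column_row s p (pos (i :: 'n)) < CARD('r)" if "pos i < s + q" for i
    using that r unfolding column_row_def by auto
  ultimately show ?thesis
    by (simp add: vec_eq_iff coordinate_projection_def)
qed

lemma sum_lessThan_split_add:
  fixes f :: "nat \<Rightarrow> 'a::comm_monoid_add"
  shows "(\<Sum>t<s + c. f t) = (\<Sum>t<s. f t) + (\<Sum>t<c. f (s + t))"
  by (induction c) (simp_all add: add.assoc)

lemma transpose_diag_I_mult:
  assumes Q: "Q \<in> orthogonal_grp (CARD('k) - s)" and "s \<le> CARD('k)"
  shows "transpose (diag_I s Q) ** diag_I s Q = (mat 1 :: real ^ 'k ^ 'k)"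
proof -
  define g where "g a b = (if a < s \<and> b < s then (if a = b then 1 else 0)
     else if s \<le> a \<and> s \<le> b then Q (a - s) (b - s) else 0)" for a b
  have entry: "(diag_I s Q :: real ^ 'k ^ 'k) $ i $ j = g (pos i) (pos j)" for i j
    by (simp add: diag_I_def g_def)
  have orth: "(\<Sum>t<CARD('k). g t a * g t b) = (if a = b then 1 else 0)"
    if ab: "a < CARD('k)" "b < CARD('k)" for a b
  proof -
    have "(\<Sum>t<CARD('k). g t a * g t b) = (\<Sum>t<s. g t a * g t b) + (\<Sum>t<CARD('k) - s. g (s + t) a * g (s + t) b)"
      using sum_lessThan_split_add[of "\<lambda>t. g t a * g t b" s "CARD('k) - s"] assms by simp
    also have "(\<Sum>t<s. g t a * g t b) = (\<Sum>t<s. if t = a then (if a < s \<and> a = b then 1 else 0) else 0)"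
      by (intro sum.cong) (auto simp: g_def)
    also have "\<dots> = (if a < s \<and> a = b then 1 else 0)"
      by simp
    also have "(\<Sum>t<CARD('k) - s. g (s + t) a * g (s + t) b) = (if s \<le> a \<and> a = b then 1 else 0)"
    proof (cases "s \<le> a \<and> s \<le> b")
      case True
      then have "(\<Sum>t<CARD('k) - s. g (s + t) a * g (s + t) b)
          = (\<Sum>t<CARD('k) - s. Q t (a - s) * Q t (b - s))"
        by (intro sum.cong) (auto simp: g_def)
      also have "\<dots> = (if a - s = b - s then 1 else 0)"
      proof -
        have "a - s < CARD('k) - s" "b - s < CARD('k) - s"
          using True ab by auto
        then show ?thesis
          using Q unfolding orthogonal_grp_def by blast
      qed
      finally show ?thesis
        using True by auto
    next
      case False
      then have "(\<Sum>t<CARD('k) - s. g (s + t) a * g (s + t) b) = 0"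
        by (intro sum.neutral) (auto simp: g_def)
      moreover have "\<not> (s \<le> a \<and> a = b)"
        using False by auto
      ultimately show ?thesis
        by presburger
    qed
    finally show ?thesis
      by auto
  qed
  have "(transpose (diag_I s Q) ** (diag_I s Q :: real ^ 'k ^ 'k)) $ i $ j = (mat 1 :: real ^ 'k ^ 'k) $ i $ j" for i j
  proof -
    have "(transpose (diag_I s Q) ** (diag_I s Q :: real ^ 'k ^ 'k)) $ i $ j
        = (\<Sum>l\<in>UNIV. g (pos (l :: 'k)) (pos i) * g (pos l) (pos j))"
      by (simp add: matrix_matrix_mult_def transpose_def entry)
    also have "\<dots> = (if pos i = pos j then 1 else 0)"
      using orth[OF pos_less_card pos_less_card, of i j] sum_pos[where 'k = 'k and g = "\<lambda>t. g t (pos i) * g t (pos j)"] by simp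
    finally show ?thesis
      by (simp add: mat_def pos_eq_iff)
  qed
  then show ?thesis
    by (simp add: vec_eq_iff)
qed

lemma diag_I_invertible:
  assumes "Q \<in> orthogonal_grp (CARD('k) - s)" and "s \<le> CARD('k)"
  shows "invertible (diag_I s Q :: real ^ 'k ^ 'k)"
  using transpose_diag_I_mult[OF assms] matrix_left_right_inverse unfolding invertible_def by blast

lemma invertible_inverse:
  fixes A :: "real ^ 'k ^ 'k"
  assumes "invertible A"
  shows "A ** matrix_inv A = mat 1" and "matrix_inv A ** A = mat 1"
proof -
  have "A ** matrix_inv A = mat 1 \<and> matrix_inv A ** A = mat 1"
    using assms unfolding invertible_def matrix_inv_def by (rule someI_ex)
  then show "A ** matrix_inv A = mat 1" and "matrix_inv A ** A = mat 1"
    by simp_all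
qed

lemma cancel_inverse_left:
  fixes A B :: "real ^ 'k ^ 'k" and C :: "real ^ 'n ^ 'k"
  assumes "A ** B = mat 1"
  shows "A ** (B ** C) = C"
  by (simp add: assms matrix_mul_assoc)

text \<open>The group action multiplies the two block matrices by invertible matrices, and \<open>G\<close> enters the factors
  in opposite ways. So the transposed blocks (with \<open>d\<close> inverted), multiplied by the inverse matrices,
  are generalized inverses, and \<open>A ** X0\<close> and \<open>Y0 ** B\<close> are coordinate projections conjugated by the
  same \<open>G\<close>. These commute, and they show what happens when one of the three differences in the slack
  vanishes.\<close>

lemma orbit_generalized_inverses:
  fixes X0 :: "real ^ 'r ^ 'm" and Y0 :: "real ^ 'n ^ 'r"
  assumes orbit: "(X0, Y0) \<in> orbit_O s U d V p q"
    and U: "orthogonal_matrix U" and V: "orthogonal_matrix V" and d: "\<forall>k<s. 0 < d k"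
    and m: "s + p \<le> CARD('m)" and n: "s + q \<le> CARD('n)" and r: "s + p + q \<le> CARD('r)"
  obtains A B where "X0 ** A ** X0 = X0" and "Y0 ** B ** Y0 = Y0" and "B ** Y0 ** B = B"
    and "(A ** X0) ** (Y0 ** B) = (Y0 ** B) ** (A ** X0)"
    and "s + p = CARD('m) \<Longrightarrow> X0 ** A = mat 1"
    and "s + q = CARD('n) \<Longrightarrow> B ** Y0 = mat 1"
    and "s + p + q = CARD('r) \<Longrightarrow> (mat 1 - A ** X0) ** (mat 1 - Y0 ** B) = 0"
proof -
  obtain Q1 G Q2 where eq: "(X0, Y0) = act s Q1 G Q2 (U ** left_block s p, right_block s d p q ** transpose V)"
    and Q1: "Q1 \<in> orthogonal_grp (CARD('m) - s)" and G: "invertible G"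
    and Q2: "Q2 \<in> orthogonal_grp (CARD('n) - s)"
    using orbit unfolding orbit_O_def by blast
  define P where "P = transpose (diag_I s Q1) ** U"
  define W where "W = transpose V ** diag_I s Q2"
  define L where "L = (left_block s p :: real ^ 'r ^ 'm)"
  define L' where "L' = (left_block s p :: real ^ 'm ^ 'r)"
  define D where "D = (right_block s d p q :: real ^ 'n ^ 'r)"
  define D' where "D' = (right_block_inverse s d p q :: real ^ 'r ^ 'n)"
  define G' where "G' = matrix_inv G"
  define P' where "P' = matrix_inv P"
  define W' where "W' = matrix_inv W"
  have "invertible (transpose (diag_I s Q1) :: real ^ 'm ^ 'm)"
    using transpose_diag_I_mult[OF Q1] m unfolding invertible_right_inverse by auto
  then have "invertible P"
    using U unfolding P_def orthogonal_matrix_def by (intro invertible_mult) (auto simp: invertible_def)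
  then have P: "P ** P' = mat 1" "P' ** P = mat 1"
    by (simp_all add: P'_def invertible_inverse)
  have "invertible W"
    using V diag_I_invertible[OF Q2] n unfolding W_def orthogonal_matrix_def
    by (intro invertible_mult) (auto simp: invertible_def)
  then have W: "W ** W' = mat 1" "W' ** W = mat 1"
    by (simp_all add: W'_def invertible_inverse)
  have GG: "G ** G' = mat 1" "G' ** G = mat 1"
    using G by (simp_all add: G'_def invertible_inverse)
  have X0: "X0 = P ** (L ** G)" and Y0: "Y0 = G' ** (D ** W)"
    using eq by (simp_all add: act_def P_def W_def L_def D_def G'_def matrix_mul_assoc)
  define A where "A = G' ** (L' ** P')"
  define B where "B = W' ** (D' ** G)"
  note assoc = matrix_mul_assoc[symmetric]
  note cancel = P[THEN cancel_inverse_left] W[THEN cancel_inverse_left] GG[THEN cancel_inverse_left]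
  have LL': "L ** L' = coordinate_projection (\<lambda>i. i < s + p)"
    unfolding L_def L'_def using r by (intro left_block_mult) simp
  have L'L: "L' ** L = coordinate_projection (\<lambda>i. i < s + p)"
    unfolding L_def L'_def using m by (intro left_block_mult) simp
  have DD': "D ** D' = coordinate_projection (nonzero_row s p q)"
    unfolding D_def D'_def using n d by (intro right_block_mult_inverse) simp_all
  have D'D: "D' ** D = coordinate_projection (\<lambda>i. i < s + q)"
    unfolding D_def D'_def using r d by (intro right_block_inverse_mult) simp_all
  have LL'L: "L ** (L' ** L) = L"
    unfolding matrix_mul_assoc LL' by (rule coordinate_projection_mult_left) (auto simp: L_def left_block_def)
  have DD'D: "D ** (D' ** D) = D"
    unfolding matrix_mul_assoc DD'
    by (rule coordinate_projection_mult_left) (simp add: D_def right_block_row)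
  have D'DD': "D' ** (D ** D') = D'"
    unfolding matrix_mul_assoc D'D
    by (rule coordinate_projection_mult_left) (simp add: D'_def right_block_inverse_def transpose_def right_block_column)
  have X0A: "X0 ** A = P ** ((L ** L') ** P')"
    by (simp add: X0 A_def assoc cancel)
  have BY0: "B ** Y0 = W' ** ((D' ** D) ** W)"
    by (simp add: Y0 B_def assoc cancel)
  have AX0: "A ** X0 = G' ** ((L' ** L) ** G)"
    by (simp add: X0 A_def assoc cancel)
  have Y0B: "Y0 ** B = G' ** ((D ** D') ** G)"
    by (simp add: Y0 B_def assoc cancel)
  have conj: "mat 1 - G' ** (C ** G) = G' ** ((mat 1 - C) ** G)" for C
    by (simp add: matrix_mult_ring_simps GG)
  show thesis
  proof (rule that)
    show "X0 ** A ** X0 = X0"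
      unfolding matrix_mul_assoc[symmetric] AX0 unfolding X0
      by (simp add: assoc cancel) (simp add: matrix_mul_assoc LL'L[unfolded matrix_mul_assoc])
    show "Y0 ** B ** Y0 = Y0"
      unfolding matrix_mul_assoc[symmetric] BY0 unfolding Y0
      by (simp add: assoc cancel) (simp add: matrix_mul_assoc DD'D[unfolded matrix_mul_assoc])
    show "B ** Y0 ** B = B"
      unfolding BY0 unfolding B_def
      by (simp add: assoc cancel) (simp add: matrix_mul_assoc D'DD'[unfolded matrix_mul_assoc])
    have "(G' ** (C ** G)) ** (G' ** (C' ** G)) = G' ** ((C ** C') ** G)" for C C'
      by (simp add: assoc cancel)
    note conj_mult = this
    show "(A ** X0) ** (Y0 ** B) = (Y0 ** B) ** (A ** X0)"
      unfolding AX0 Y0B conj_mult L'L DD' coordinate_projection_mult by (simp add: conj_commute)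
    show "X0 ** A = mat 1" if "s + p = CARD('m)"
      unfolding X0A LL' using that by (simp add: coordinate_projection_eq_mat_1 P)
    show "B ** Y0 = mat 1" if "s + q = CARD('n)"
      unfolding BY0 D'D using that by (simp add: coordinate_projection_eq_mat_1 W)
    show "(mat 1 - A ** X0) ** (mat 1 - Y0 ** B) = 0" if r': "s + p + q = CARD('r)"
    proof -
      have "(coordinate_projection (\<lambda>i. \<not> i < s + p \<and> \<not> nonzero_row s p q i) :: real ^ 'r ^ 'r) = 0"
        using r' by (intro coordinate_projection_eq_0) (auto simp: nonzero_row_def)
      then show ?thesis
        unfolding AX0 Y0B conj conj_mult L'L DD' mat_1_minus_coordinate_projection coordinate_projection_mult
        by (simp add: matrix_mult_zero)
    qed
  qed
qed


section \<open>The exponents on the sets O(p,q)\<close>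

text \<open>Generalized inverses can be multiplied in reverse order like inverses if the projections \<open>A ** X0\<close> and
  \<open>Y0 ** B\<close> commute: exchanging them in the middle of the triple product separates the two factors.\<close>

lemma generalized_inverse_product:
  fixes X0 :: "real ^ 'r ^ 'm" and Y0 :: "real ^ 'n ^ 'r"
  assumes A: "X0 ** A ** X0 = X0" and B: "Y0 ** B ** Y0 = Y0"
    and commute: "(A ** X0) ** (Y0 ** B) = (Y0 ** B) ** (A ** X0)"
  shows "(X0 ** Y0) ** (B ** A) ** (X0 ** Y0) = X0 ** Y0"
proof -
  have "(X0 ** Y0) ** (B ** A) ** (X0 ** Y0) = X0 ** ((Y0 ** B) ** (A ** X0)) ** Y0"
    by (simp only: matrix_mul_assoc)
  also have "\<dots> = (X0 ** A ** X0) ** (Y0 ** B ** Y0)"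
    unfolding commute[symmetric] by (simp only: matrix_mul_assoc)
  finally show ?thesis
    by (simp only: A B)
qed

lemma slack_nonneg_imp_le:
  assumes "0 \<le> slack m r n s p q"
  shows "s + p \<le> m" and "s + q \<le> n" and "s + p + q \<le> r"
  using assms by (simp_all add: slack_def)

lemma slack_eq_0_cases:
  assumes "slack m r n s p q = 0"
  obtains "s + p = m" | "s + q = n" | "s + p + q = r"
  using assms by (auto simp: slack_def min_def split: if_splits)

text \<open>The three ways in which the slack can vanish are the three cases of a bounded solution above:
  \<open>X0\<close> has full row rank, \<open>Y0\<close> has full column rank, or the kernel of \<open>X0\<close> lies in the range of \<open>Y0\<close>.\<close>

lemma orbit_product_error_linearizable:
  fixes X0 :: "real ^ 'r ^ 'm" and Y0 :: "real ^ 'n ^ 'r"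
  assumes orbit: "(X0, Y0) \<in> orbit_O s U d V p q" and svd: "is_svd s U d V (M :: real ^ 'n ^ 'm)"
    and slack: "0 \<le> slack CARD('m) CARD('r) CARD('n) s p q"
  shows "product_error_linearizable (1 / 2) X0 Y0"
    and "slack CARD('m) CARD('r) CARD('n) s p q = 0 \<Longrightarrow> product_error_linearizable 1 X0 Y0"
proof -
  have U: "orthogonal_matrix U" and V: "orthogonal_matrix V" and d: "\<forall>k<s. 0 < d k"
    using svd by (simp_all add: is_svd_def)
  obtain A B where A: "X0 ** A ** X0 = X0" and B: "Y0 ** B ** Y0 = Y0" "B ** Y0 ** B = B"
    and commute: "(A ** X0) ** (Y0 ** B) = (Y0 ** B) ** (A ** X0)"
    and m: "s + p = CARD('m) \<Longrightarrow> X0 ** A = mat 1"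
    and n: "s + q = CARD('n) \<Longrightarrow> B ** Y0 = mat 1"
    and r: "s + p + q = CARD('r) \<Longrightarrow> (mat 1 - A ** X0) ** (mat 1 - Y0 ** B) = 0"
    using orbit_generalized_inverses[OF orbit U V d slack_nonneg_imp_le[OF slack]] by metis
  note product = generalized_inverse_product[OF A B(1) commute]
  show "product_error_linearizable (1 / 2) X0 Y0"
    by (rule product_error_linearizable_half[OF product])
  assume "slack CARD('m) CARD('r) CARD('n) s p q = 0"
  then show "product_error_linearizable 1 X0 Y0"
  proof (cases rule: slack_eq_0_cases)
    case 1
    then show ?thesis
      using m product_error_linearizable_one_if_right_inverse by blast
  next
    case 2
    then show ?thesis
      using n product_error_linearizable_one_if_left_inverse by blast
  next
    case 3
    then show ?thesis
      using r product_error_linearizable_one_if_kernel_in_range[OF A B(2) product] by blast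
  qed
qed

theorem corollary4p26:
  fixes M :: "real ^ 'n ^ 'm"
    and \<A> :: "real ^ 'n ^ 'm \<Rightarrow> real ^ 'N"
    and b :: "real ^ 'N"
    and \<delta> :: real
    and s :: nat
    and U :: "real ^ 'm ^ 'm" and d :: "nat \<Rightarrow> real" and V :: "real ^ 'n ^ 'n"
    and Xb :: "real ^ 'r ^ 'm" and Yb :: "real ^ 'n ^ 'r"
  assumes "rank M = s" and "s \<le> CARD('r)"
    and "is_svd s U d V M"
    and "linear \<A>"
    and "0 < \<delta>" and "\<delta> < 1"
    and "RIP \<delta> (s + CARD('r)) (s + CARD('r)) (g_ms \<A> b)"
    and "\<forall>A. g_ms \<A> b M \<le> g_ms \<A> b A"
    and "Xb ** Yb = M"
  shows "(\<forall>p q. (Xb, Yb) \<in> orbit_O s U d V p q \<and>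
             slack CARD('m) CARD('r) CARD('n) s p q = 0 \<longrightarrow>
           has_KL_exponent (f_1 M :: (real ^ 'r ^ 'm) \<times> (real ^ 'n ^ 'r) \<Rightarrow> real) 0 (Xb, Yb) \<and>
           has_KL_exponent (f_ms \<A> b :: (real ^ 'r ^ 'm) \<times> (real ^ 'n ^ 'r) \<Rightarrow> real) (1 / 2) (Xb, Yb)) \<and>
         (\<forall>p q. (Xb, Yb) \<in> orbit_O s U d V p q \<and>
             slack CARD('m) CARD('r) CARD('n) s p q > 0 \<longrightarrow>
           has_KL_exponent (f_1 M :: (real ^ 'r ^ 'm) \<times> (real ^ 'n ^ 'r) \<Rightarrow> real) (1 / 2) (Xb, Yb) \<and>
           has_KL_exponent (f_ms \<A> b :: (real ^ 'r ^ 'm) \<times> (real ^ 'n ^ 'r) \<Rightarrow> real) (3 / 4) (Xb, Yb))"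
proof -
  have M: "Xb ** Yb = M" and rank: "rank (Xb ** Yb) = s"
    using assms by simp_all
  have RIP: "RIP \<delta> (s + CARD('r)) (rank (Xb ** Yb) + CARD('r)) (g_ms \<A> b)"
    using assms(7) by (simp only: rank)
  have min: "\<forall>A. g_ms \<A> b (Xb ** Yb) \<le> g_ms \<A> b A"
    unfolding M by (rule assms(8))
  note linearizable = orbit_product_error_linearizable[OF _ assms(3)]
  have f_1: "has_KL_exponent (f_1 M :: (real ^ 'r ^ 'm) \<times> (real ^ 'n ^ 'r) \<Rightarrow> real) (1 - \<theta>) (Xb, Yb)"
    if "product_error_linearizable \<theta> Xb Yb" "0 < \<theta>" "\<theta> \<le> 1" for \<theta>
    using f_1_has_KL_exponent[OF that(2,3,1)] by (simp only: M)
  have f_ms: "has_KL_exponent (f_ms \<A> b :: (real ^ 'r ^ 'm) \<times> (real ^ 'n ^ 'r) \<Rightarrow> real) (1 - \<theta> / 2) (Xb, Yb)"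
    if "product_error_linearizable \<theta> Xb Yb" "0 < \<theta>" "\<theta> \<le> 2" for \<theta>
    using f_ms_has_KL_exponent[OF assms(4,6) RIP min that(2,3,1)] .
  show ?thesis
  proof (intro conjI allI impI; elim conjE)
    fix p q
    assume orbit: "(Xb, Yb) \<in> orbit_O s U d V p q"
      and slack: "slack CARD('m) CARD('r) CARD('n) s p q = 0"
    have one: "product_error_linearizable 1 Xb Yb"
      using linearizable(2)[OF orbit] slack by simp
    show "has_KL_exponent (f_1 M :: (real ^ 'r ^ 'm) \<times> (real ^ 'n ^ 'r) \<Rightarrow> real) 0 (Xb, Yb)"
      using f_1[OF one] by simp
    show "has_KL_exponent (f_ms \<A> b :: (real ^ 'r ^ 'm) \<times> (real ^ 'n ^ 'r) \<Rightarrow> real) (1 / 2) (Xb, Yb)"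
      using f_ms[OF one] by simp
  next
    fix p q
    assume orbit: "(Xb, Yb) \<in> orbit_O s U d V p q"
      and slack: "slack CARD('m) CARD('r) CARD('n) s p q > 0"
    have half: "product_error_linearizable (1 / 2) Xb Yb"
      using linearizable(1)[OF orbit] slack by simp
    show "has_KL_exponent (f_1 M :: (real ^ 'r ^ 'm) \<times> (real ^ 'n ^ 'r) \<Rightarrow> real) (1 / 2) (Xb, Yb)"
      using f_1[OF half] by simp
    show "has_KL_exponent (f_ms \<A> b :: (real ^ 'r ^ 'm) \<times> (real ^ 'n ^ 'r) \<Rightarrow> real) (3 / 4) (Xb, Yb)"
      using f_ms[OF half] by simp
  qed
qed

end
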